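(* Let $Z$ be a compact metrizable space and let $m$ be the Lebesgue measure on $[0,1]$. Then there is a family $$\big(k^\mu\colon([0,1],m)\to([0,1]\times Z,\ m\times\mu)\big)_{\mu\in\operatorname{Prob}(Z)}$$ of measure space isomorphisms mod $0$ that is continuous in the sense that for every continuous function $h\in C([0,1]\times Z)$, the assignment $\mu\mapsto h\circ k^\mu$ yields a continuous map $\operatorname{Prob}(Z)\to L^2([0,1],m)$.
   Context: $\operatorname{Prob}(Z)$ is the space of regular Borel probability measures on $Z$ with the weak-$*$ topology (the coarsest topology making $\mu\mapsto\int_Z f\,d\mu$ continuous for every continuous $f\colon Z\to\mathbb R$). $L^2([0,1],m)$ carries the norm topology. A measure space isomorphism mod $0$ is a measure-preserving bimeasurable bijection between conull measurable subsets. *)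

theory Defs
  imports "HOL-Probability.Probability"
begin

definition borel_of :: "'a topology \<Rightarrow> 'a measure" where
  "borel_of Z = sigma (topspace Z) {U. openin Z U}"

definition regular_measure :: "'a topology \<Rightarrow> 'a measure \<Rightarrow> bool" where
  "regular_measure Z \<mu> \<longleftrightarrow>
     (\<forall>E\<in>sets \<mu>.
        emeasure \<mu> E = (SUP K\<in>{K. compactin Z K \<and> K \<subseteq> E}. emeasure \<mu> K) \<and>
        emeasure \<mu> E = (INF U\<in>{U. openin Z U \<and> E \<subseteq> U}. emeasure \<mu> U))"

definition Prob :: "'a topology \<Rightarrow> 'a measure set" where
  "Prob Z = {\<mu>. sets \<mu> = sets (borel_of Z) \<and> prob_space \<mu> \<and> regular_measure Z \<mu>}"

text \<open>The underlying set is \<open>Prob Z\<close> (take \<open>f\<close> constant and \<open>U = UNIV\<close>).\<close>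

definition weak_star_topology :: "'a topology \<Rightarrow> 'a measure topology" where
  "weak_star_topology Z = topology_generated_by
     {{\<mu> \<in> Prob Z. (\<integral>z. f z \<partial>\<mu>) \<in> U} | f U.
        continuous_map Z euclideanreal f \<and> open U}"

lemma topspace_weak_star_topology: "topspace (weak_star_topology Z) = Prob Z"
proof -
  have "Prob Z \<in> {{\<mu> \<in> Prob Z. (\<integral>z. f z \<partial>\<mu>) \<in> U} | f U.
        continuous_map Z euclideanreal f \<and> open U}"
    by (rule CollectI, rule exI[of _ "\<lambda>_. 0"], rule exI[of _ UNIV]) auto
  then show ?thesis
    unfolding weak_star_topology_def by auto
qed

text \<open>
  Real \<open>L\<^sup>2\<close> as a space of classes modulo almost everywhere equality.  The representative \<open>f\<close>
  of \<open>L2_class M f\<close> only needs to agree almost everywhere with a measurable function, so it may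
  be defined merely on a conull set; the class is empty iff \<open>f\<close> is not almost everywhere equal to
  a square-integrable measurable function.
\<close>

definition L2_fun :: "'a measure \<Rightarrow> ('a \<Rightarrow> real) set" where
  "L2_fun M = {f \<in> borel_measurable M. integrable M (\<lambda>x. (f x)\<^sup>2)}"

definition L2_class :: "'a measure \<Rightarrow> ('a \<Rightarrow> real) \<Rightarrow> ('a \<Rightarrow> real) set" where
  "L2_class M f = {g \<in> L2_fun M. AE x in M. g x = f x}"

definition L2 :: "'a measure \<Rightarrow> ('a \<Rightarrow> real) set set" where
  "L2 M = L2_class M ` L2_fun M"

definition L2_dist :: "'a measure \<Rightarrow> ('a \<Rightarrow> real) set \<Rightarrow> ('a \<Rightarrow> real) set \<Rightarrow> real" where
  "L2_dist M F G =
     (let f = (SOME f. f \<in> F); g = (SOME g. g \<in> G) in sqrt (\<integral>x. (f x - g x)\<^sup>2 \<partial>M))"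

definition L2_topology :: "'a measure \<Rightarrow> ('a \<Rightarrow> real) set topology" where
  "L2_topology M = Metric_space.mtopology (L2 M) (L2_dist M)"

lemma L2_fun_mult_integrable:
  assumes "f \<in> L2_fun M" "g \<in> L2_fun M"
  shows "integrable M (\<lambda>x. f x * g x)"
proof (rule Bochner_Integration.integrable_bound)
  show "integrable M (\<lambda>x. (f x)\<^sup>2 + (g x)\<^sup>2)"
    using assms by (auto simp: L2_fun_def)
  show "(\<lambda>x. f x * g x) \<in> borel_measurable M"
    using assms by (auto simp: L2_fun_def)
  show "AE x in M. norm (f x * g x) \<le> norm ((f x)\<^sup>2 + (g x)\<^sup>2)"
  proof (rule AE_I2)
    fix x
    have "2 * (\<bar>f x\<bar> * \<bar>g x\<bar>) \<le> (f x)\<^sup>2 + (g x)\<^sup>2"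
      using sum_squares_bound[of "\<bar>f x\<bar>" "\<bar>g x\<bar>"] by (simp add: mult.assoc)
    moreover have "0 \<le> \<bar>f x\<bar> * \<bar>g x\<bar>" by simp
    moreover have "\<bar>(f x)\<^sup>2 + (g x)\<^sup>2\<bar> = (f x)\<^sup>2 + (g x)\<^sup>2" by simp
    ultimately show "norm (f x * g x) \<le> norm ((f x)\<^sup>2 + (g x)\<^sup>2)"
      unfolding real_norm_def abs_mult by linarith
  qed
qed

lemma L2_fun_lincomb:
  assumes "f \<in> L2_fun M" "g \<in> L2_fun M"
  shows "(\<lambda>x. f x + t * g x) \<in> L2_fun M"
    and "(\<integral>x. (f x + t * g x)\<^sup>2 \<partial>M) =
      (\<integral>x. (f x)\<^sup>2 \<partial>M) + 2 * t * (\<integral>x. f x * g x \<partial>M) + t\<^sup>2 * (\<integral>x. (g x)\<^sup>2 \<partial>M)"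
proof -
  have i: "integrable M (\<lambda>x. f x * g x)" "integrable M (\<lambda>x. (f x)\<^sup>2)" "integrable M (\<lambda>x. (g x)\<^sup>2)"
    using assms L2_fun_mult_integrable by (auto simp: L2_fun_def)
  have e: "(\<lambda>x. (f x + t * g x)\<^sup>2) = (\<lambda>x. (f x)\<^sup>2 + 2 * t * (f x * g x) + t\<^sup>2 * (g x)\<^sup>2)"
    by (simp add: power2_eq_square algebra_simps)
  have "integrable M (\<lambda>x. (f x + t * g x)\<^sup>2)"
    unfolding e using i by simp
  then show "(\<lambda>x. f x + t * g x) \<in> L2_fun M"
    using assms by (auto simp: L2_fun_def)
  show "(\<integral>x. (f x + t * g x)\<^sup>2 \<partial>M) =
      (\<integral>x. (f x)\<^sup>2 \<partial>M) + 2 * t * (\<integral>x. f x * g x \<partial>M) + t\<^sup>2 * (\<integral>x. (g x)\<^sup>2 \<partial>M)"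
    unfolding e using i by simp
qed

lemma L2_fun_diff:
  assumes "f \<in> L2_fun M" "g \<in> L2_fun M"
  shows "(\<lambda>x. f x - g x) \<in> L2_fun M"
  using L2_fun_lincomb(1)[OF assms, of "-1"] by simp

lemma L2_triangle:
  assumes "f \<in> L2_fun M" "g \<in> L2_fun M"
  shows "sqrt (\<integral>x. (f x + g x)\<^sup>2 \<partial>M) \<le> sqrt (\<integral>x. (f x)\<^sup>2 \<partial>M) + sqrt (\<integral>x. (g x)\<^sup>2 \<partial>M)"
proof -
  define a b c where "a = (\<integral>x. (f x)\<^sup>2 \<partial>M)" and "b = (\<integral>x. f x * g x \<partial>M)"
    and "c = (\<integral>x. (g x)\<^sup>2 \<partial>M)"
  have nn: "0 \<le> a" "0 \<le> c" by (auto simp: a_def c_def)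
  have q: "0 \<le> a + 2 * t * b + t\<^sup>2 * c" for t
    using L2_fun_lincomb(2)[OF assms, of t] integral_nonneg_AE[of "\<lambda>x. (f x + t * g x)\<^sup>2" M]
    by (simp add: a_def b_def c_def)
  have "b\<^sup>2 \<le> a * c"
  proof (cases "c = 0")
    case True
    have "b = 0"
    proof (rule ccontr)
      assume "b \<noteq> 0"
      then show False using q[of "- (a + 1) / (2 * b)"] True nn by (simp add: field_simps)
    qed
    then show ?thesis using True by simp
  next
    case False
    then have "c > 0" using nn by simp
    have "0 \<le> a - b\<^sup>2 / c"
      using q[of "- b / c"] False by (simp add: power2_eq_square field_simps)
    then show ?thesis using \<open>c > 0\<close> by (simp add: field_simps)
  qed
  then have "b \<le> sqrt a * sqrt c"
    by (metis real_le_rsqrt real_sqrt_mult)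
  then have "a + 2 * b + c \<le> (sqrt a + sqrt c)\<^sup>2"
    using nn by (simp add: power2_sum)
  then have "sqrt (a + 2 * b + c) \<le> sqrt a + sqrt c"
    using nn by (intro real_le_lsqrt) auto
  then show ?thesis
    using L2_fun_lincomb(2)[OF assms, of 1] by (simp add: a_def b_def c_def)
qed

lemma L2_class_self: "f \<in> L2_fun M \<Longrightarrow> f \<in> L2_class M f"
  by (simp add: L2_class_def)

lemma L2_class_eq_iff:
  assumes "f \<in> L2_fun M" "g \<in> L2_fun M"
  shows "L2_class M f = L2_class M g \<longleftrightarrow> (AE x in M. f x = g x)"
proof
  assume "L2_class M f = L2_class M g"
  then show "AE x in M. f x = g x"
    using L2_class_self[OF assms(1)] by (auto simp: L2_class_def)
next
  assume ae: "AE x in M. f x = g x"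
  have "(AE x in M. h x = f x) \<longleftrightarrow> (AE x in M. h x = g x)" for h
  proof
    assume "AE x in M. h x = f x" then show "AE x in M. h x = g x"
      using ae by eventually_elim simp
  next
    assume "AE x in M. h x = g x" then show "AE x in M. h x = f x"
      using ae by eventually_elim simp
  qed
  then show "L2_class M f = L2_class M g"
    by (simp add: L2_class_def)
qed

lemma L2_dist_class:
  assumes "f \<in> L2_fun M" "g \<in> L2_fun M"
  shows "L2_dist M (L2_class M f) (L2_class M g) = sqrt (\<integral>x. (f x - g x)\<^sup>2 \<partial>M)"
proof -
  define f' where "f' = (SOME h. h \<in> L2_class M f)"
  define g' where "g' = (SOME h. h \<in> L2_class M g)"
  have f': "f' \<in> L2_class M f" unfolding f'_def using L2_class_self[OF assms(1)] by (rule someI[of "\<lambda>h. h \<in> _"])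
  have g': "g' \<in> L2_class M g" unfolding g'_def using L2_class_self[OF assms(2)] by (rule someI[of "\<lambda>h. h \<in> _"])
  have m: "f' \<in> borel_measurable M" "g' \<in> borel_measurable M"
      "f \<in> borel_measurable M" "g \<in> borel_measurable M"
    using f' g' assms by (auto simp: L2_class_def L2_fun_def)
  have ae: "AE x in M. f' x = f x" "AE x in M. g' x = g x"
    using f' g' by (auto simp: L2_class_def)
  have "(\<integral>x. (f' x - g' x)\<^sup>2 \<partial>M) = (\<integral>x. (f x - g x)\<^sup>2 \<partial>M)"
    by (rule integral_cong_AE) (use m ae in auto)
  then show ?thesis by (simp add: L2_dist_def f'_def g'_def Let_def)
qed

lemma Metric_space_L2: "Metric_space (L2 M) (L2_dist M)"
proof
  fix F G show "0 \<le> L2_dist M F G" by (simp add: L2_dist_def Let_def)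
next
  fix F G show "L2_dist M F G = L2_dist M G F"
    by (simp add: L2_dist_def Let_def power2_commute)
next
  fix F G assume "F \<in> L2 M" "G \<in> L2 M"
  then obtain f g where fg: "f \<in> L2_fun M" "g \<in> L2_fun M" "F = L2_class M f" "G = L2_class M g"
    by (auto simp: L2_def)
  have "integrable M (\<lambda>x. (f x - g x)\<^sup>2)"
    using L2_fun_diff[OF fg(1,2)] by (simp add: L2_fun_def)
  then have "(\<integral>x. (f x - g x)\<^sup>2 \<partial>M) = 0 \<longleftrightarrow> (AE x in M. (f x - g x)\<^sup>2 = 0)"
    by (rule integral_nonneg_eq_0_iff_AE) auto
  then show "L2_dist M F G = 0 \<longleftrightarrow> F = G"
    using fg by (simp add: L2_dist_class L2_class_eq_iff)
next
  fix F G H assume "F \<in> L2 M" "G \<in> L2 M" "H \<in> L2 M"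
  then obtain f g h where fgh: "f \<in> L2_fun M" "g \<in> L2_fun M" "h \<in> L2_fun M"
      "F = L2_class M f" "G = L2_class M g" "H = L2_class M h"
    by (auto simp: L2_def)
  show "L2_dist M F H \<le> L2_dist M F G + L2_dist M G H"
    using L2_triangle[OF L2_fun_diff[OF fgh(1,2)] L2_fun_diff[OF fgh(2,3)]] fgh
    by (simp add: L2_dist_class)
qed

lemma topspace_L2_topology: "topspace (L2_topology M) = L2 M"
  unfolding L2_topology_def by (rule Metric_space.topspace_mtopology[OF Metric_space_L2])

text \<open>Nothing is required of \<open>k\<close> outside \<open>A\<close>.\<close>

definition iso_mod0 :: "'a measure \<Rightarrow> 'b measure \<Rightarrow> ('a \<Rightarrow> 'b) \<Rightarrow> bool" where
  "iso_mod0 M N k \<longleftrightarrow>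
     (\<exists>A\<in>sets M. \<exists>B\<in>sets N.
        space M - A \<in> null_sets M \<and> space N - B \<in> null_sets N \<and>
        bij_betw k A B \<and>
        k \<in> measurable (restrict_space M A) (restrict_space N B) \<and>
        the_inv_into A k \<in> measurable (restrict_space N B) (restrict_space M A) \<and>
        distr (restrict_space M A) (restrict_space N B) k = restrict_space N B)"

text \<open>
  Borel sets, not the completed Lebesgue sets, are used on \<open>[0,1]\<close>: the product
  \<open>\<Otimes>\<^sub>M\<close> is not completed, and a bimeasurable bijection needs the two sides to match.
\<close>

definition unit_leb :: "real measure" where
  "unit_leb = restrict_space lborel {0..1}"

end

theory Submission
  imports Defs
begin

text \<open>
  Embed \<open>Z\<close> in a Hilbert cube by functions \<open>f i\<close> and consider the binary digits of the numbers
  \<open>(s + f i z) / 3\<close>.  Interleaved into a Cantor expansion they give an injective Borel map \<open>\<Phi>\<close> from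
  \<open>[0,1] \<times> Z\<close> to the line whose inverse is continuous on a compact set and such that, for each \<open>z\<close>
  and all but countably many \<open>s\<close>, \<open>\<Phi> (s, _)\<close> is continuous at \<open>z\<close>.  The image \<open>\<nu>\<close> of \<open>m \<times> \<mu>\<close>
  under \<open>\<Phi>\<close> is then atomless, and its distribution function depends continuously on \<open>\<mu>\<close> at every
  point.  The quantile function of \<open>\<nu>\<close>, followed by the inverse of \<open>\<Phi>\<close>, is the required
  isomorphism: two quantile functions are separated by a point \<open>r\<close> only on a set of measure the
  difference of the distribution functions at \<open>r\<close>, so a finite grid of points controls the
  \<open>L\<^sup>2\<close> distance.
\<close>

section \<open>Borel coding of a product with the interval\<close>

text \<open>Closed sets of a metric space are the sequentially closed ones, so preimages of closed
  sets can be tested on sequences. This form suits functions given by integrals, where dominated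
  convergence handles sequences.\<close>

lemma continuous_map_sequentiallyI:
  assumes X: "metrizable_space X"
    and lim: "\<And>\<sigma> x. range \<sigma> \<subseteq> topspace X \<Longrightarrow> limitin X \<sigma> x sequentially \<Longrightarrow> (\<lambda>n. g (\<sigma> n)) \<longlonglongrightarrow> g x"
  shows "continuous_map X euclideanreal g"
proof -
  obtain M d where "Metric_space M d" and Xeq: "X = Metric_space.mtopology M d"
    using X unfolding metrizable_space_def by blast
  then interpret Metric_space M d by simp
  show ?thesis
    unfolding continuous_map_closedin
  proof (intro conjI allI impI)
    fix C :: "real set" assume "closedin euclideanreal C"
    then have C: "closed C" by simp
    show "closedin X {x \<in> topspace X. g x \<in> C}"
      unfolding Xeq metric_closedin_iff_sequentially_closed
    proof (intro conjI allI impI)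
      fix \<sigma> l assume *: "range \<sigma> \<subseteq> {x \<in> topspace mtopology. g x \<in> C} \<and> limitin mtopology \<sigma> l sequentially"
      then have l: "l \<in> topspace mtopology" by (auto dest: limitin_topspace)
      have "(\<lambda>n. g (\<sigma> n)) \<longlonglongrightarrow> g l" using * by (intro lim) (auto simp: Xeq)
      moreover have "\<forall>n. g (\<sigma> n) \<in> C" using * by auto
      ultimately have "g l \<in> C" using Lim_in_closed_set[OF C always_eventually sequentially_bot] by metis
      with l show "l \<in> {x \<in> topspace mtopology. g x \<in> C}" by simp
    qed auto
  qed auto
qed

text \<open>Distances to the points of a countable dense set, truncated to \<open>[0, 1]\<close>,
  separate points. Total boundedness supplies the dense set as a union of finite nets.\<close>

lemma compact_metrizable_separating_functions:
  assumes "compact_space Z" "metrizable_space Z"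
  obtains f :: "nat \<Rightarrow> 'a \<Rightarrow> real"
  where "\<And>i. continuous_map Z euclideanreal (f i)" "\<And>i z. f i z \<in> {0..1}"
    "\<And>x y. x \<in> topspace Z \<Longrightarrow> y \<in> topspace Z \<Longrightarrow> (\<And>i. f i x = f i y) \<Longrightarrow> x = y"
proof (cases "topspace Z = {}")
  case True
  then show thesis by (intro that[of "\<lambda>_ _. 0"]) auto
next
  case False
  obtain M d where "Metric_space M d" and Zeq: "Z = Metric_space.mtopology M d"
    using assms unfolding metrizable_space_def by blast
  then interpret Metric_space M d by simp
  have "M \<noteq> {}" using False by (simp add: Zeq)
  have tb: "mtotally_bounded M"
    using assms(1) by (simp add: Zeq compact_space_eq_mcomplete_mtotally_bounded)
  then have "\<exists>K. finite K \<and> K \<subseteq> M \<and> M \<subseteq> (\<Union>x\<in>K. mball x (inverse (Suc n)))" for n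
    unfolding mtotally_bounded_def by simp
  then obtain K where K: "\<And>n. finite (K n)" "\<And>n. K n \<subseteq> M"
      "\<And>n. M \<subseteq> (\<Union>x\<in>K n. mball x (inverse (Suc n)))"
    by metis
  define D where "D = (\<Union>n. K n)"
  have D: "countable D" "D \<subseteq> M" using K by (auto simp: D_def intro: countable_finite)
  have "D \<noteq> {}" using K(3)[of 0] \<open>M \<noteq> {}\<close> by (auto simp: D_def)
  define f where "f i z = min 1 (max 0 (d (from_nat_into D i) z))" for i z
  show thesis
  proof
    fix i
    have p: "from_nat_into D i \<in> M" using from_nat_into[OF \<open>D \<noteq> {}\<close>] D by auto
    show "continuous_map Z euclideanreal (f i)"
      unfolding f_def
    proof (intro continuous_map_real_min continuous_map_real_max continuous_map_sequentiallyI)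
      fix \<sigma> x assume \<sigma>: "range \<sigma> \<subseteq> topspace Z" "limitin Z \<sigma> x sequentially"
      then have x: "x \<in> M" "(\<lambda>n. d (\<sigma> n) x) \<longlonglongrightarrow> 0"
        by (auto simp: Zeq limitin_metric_dist_null)
      have "\<bar>d (from_nat_into D i) (\<sigma> n) - d (from_nat_into D i) x\<bar> \<le> d (\<sigma> n) x" for n
      proof -
        have "\<sigma> n \<in> M" using \<sigma> by (auto simp: Zeq)
        then show ?thesis
          using mdist_reverse_triangle[OF \<open>\<sigma> n \<in> M\<close> p x(1)] by (simp add: commute)
      qed
      then show "(\<lambda>n. d (from_nat_into D i) (\<sigma> n)) \<longlonglongrightarrow> d (from_nat_into D i) x"
        by (intro Lim_transform_bound[OF _ x(2), THEN LIM_zero_cancel]) auto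
    qed (use assms in auto)
  next
    fix x y assume xy: "x \<in> topspace Z" "y \<in> topspace Z" and eq: "\<And>i. f i x = f i y"
    have M: "x \<in> M" "y \<in> M" using xy by (auto simp: Zeq)
    have "d x y < e" if "e > 0" for e
    proof -
      \<comment> \<open>The bound \<open>1/2\<close> keeps the distance from a net point to
        \<open>x\<close> clear of the truncation at 1; the bound \<open>e/2\<close> is spent once
        for \<open>x\<close> and once for \<open>y\<close>.\<close>
      obtain n where n: "inverse (real (Suc n)) < min (1/2) (e/2)"
        using reals_Archimedean[of "min (1/2) (e/2)"] \<open>e > 0\<close> by fastforce
      obtain p where p: "p \<in> K n" "x \<in> mball p (inverse (Suc n))" using K(3) M by blast
      have "p \<in> D" using p by (auto simp: D_def)
      then obtain i where i: "from_nat_into D i = p" using D(1)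
        by (metis from_nat_into_to_nat_on)
      have "d p x < inverse (Suc n)" "p \<in> M" using p by auto
      moreover have "d p y = d p x"
        using eq[of i] n \<open>d p x < inverse (Suc n)\<close> nonneg[of p x] nonneg[of p y]
        by (auto simp: f_def i min_def max_def split: if_splits)
      ultimately show ?thesis
        using n triangle[OF M(1) \<open>p \<in> M\<close> M(2)] by (simp add: commute)
    qed
    then show "x = y" using M by (meson less_irrefl mdist_pos_eq)
  qed (auto simp: f_def)
qed

section \<open>Binary and ternary digit series\<close>

text \<open>Halving and rounding down drops the last binary digit, so the first \<open>J\<close>
  terms add up to \<open>\<lfloor>2 ^ J * x\<rfloor> / 2 ^ J\<close>, which is within
  \<open>(1/2) ^ J\<close> of \<open>x\<close>.\<close>

lemma binary_digit_sums:
  fixes x :: real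
  assumes "0 \<le> x" "x < 1"
  shows "(\<lambda>j. of_int (\<lfloor>2 ^ Suc j * x\<rfloor> mod 2) / 2 ^ Suc j) sums x"
proof -
  have part: "(\<Sum>j<J. real_of_int (\<lfloor>2 ^ Suc j * x\<rfloor> mod 2) / 2 ^ Suc j) = of_int \<lfloor>2 ^ J * x\<rfloor> / 2 ^ J" for J
  proof (induction J)
    case 0
    have "\<lfloor>x\<rfloor> = 0" using assms by linarith
    then show ?case by simp
  next
    case (Suc J)
    have "\<lfloor>2 ^ J * x\<rfloor> = \<lfloor>2 ^ Suc J * x\<rfloor> div 2"
      using floor_divide_real_eq_div[of 2 "2 ^ Suc J * x"] by simp
    then have "\<lfloor>2 ^ Suc J * x\<rfloor> = 2 * \<lfloor>2 ^ J * x\<rfloor> + \<lfloor>2 ^ Suc J * x\<rfloor> mod 2" by simp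
    then have "real_of_int \<lfloor>2 ^ Suc J * x\<rfloor> = 2 * of_int \<lfloor>2 ^ J * x\<rfloor> + of_int (\<lfloor>2 ^ Suc J * x\<rfloor> mod 2)"
      by linarith
    then show ?case
      using Suc by (simp add: field_simps)
  qed
  have lim: "(\<lambda>J. x - (1/2) ^ J) \<longlonglongrightarrow> x - 0"
    by (intro tendsto_intros) auto
  show ?thesis
    unfolding sums_def part
  proof (rule tendsto_sandwich[OF _ _ _ tendsto_const])
    show "\<forall>\<^sub>F J in sequentially. x - (1/2) ^ J \<le> of_int \<lfloor>2 ^ J * x\<rfloor> / 2 ^ J"
    proof (rule always_eventually, rule allI)
      fix J :: nat
      have "2 ^ J * x - 1 \<le> of_int \<lfloor>2 ^ J * x\<rfloor>" by linarith
      then have "(2 ^ J * x - 1) / 2 ^ J \<le> of_int \<lfloor>2 ^ J * x\<rfloor> / 2 ^ J"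
        by (intro divide_right_mono) auto
      moreover have "(2 ^ J * x - 1) / 2 ^ J = x - (1/2) ^ J"
        by (simp add: diff_divide_distrib power_one_over)
      ultimately show "x - (1/2) ^ J \<le> of_int \<lfloor>2 ^ J * x\<rfloor> / 2 ^ J" by simp
    qed
    show "\<forall>\<^sub>F J in sequentially. of_int \<lfloor>2 ^ J * x\<rfloor> / 2 ^ J \<le> x"
    proof (rule always_eventually, rule allI)
      fix J :: nat
      show "of_int \<lfloor>2 ^ J * x\<rfloor> / 2 ^ J \<le> x"
        using of_int_floor_le[of "2 ^ J * x"] by (simp add: field_simps)
    qed
    show "(\<lambda>J. x - (1/2) ^ J) \<longlonglongrightarrow> x" using lim by simp
  qed
qed

text \<open>Digits are real numbers so that the cube is a compact subset of
  \<open>nat \<Rightarrow> real\<close> in its product topology.\<close>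

definition cantor_cube :: "(nat \<Rightarrow> real) set" where
  "cantor_cube = {c. \<forall>n. c n \<in> {0, 1}}"

text \<open>At \<open>q = 1/3\<close> the series encodes a digit sequence injectively; at
  \<open>q = 1/2\<close> it evaluates a binary expansion, doubled because the exponents start at
  0.\<close>

definition digit_series :: "real \<Rightarrow> (nat \<Rightarrow> real) \<Rightarrow> real" where
  "digit_series q c = (\<Sum>n. c n * q ^ n)"

lemma compact_cantor_cube: "compact cantor_cube"
proof -
  have "cantor_cube = Pi\<^sub>E UNIV (\<lambda>_. {0, 1})"
    by (auto simp: cantor_cube_def PiE_def)
  moreover have "compactin (product_topology (\<lambda>_::nat. euclideanreal) UNIV) (Pi\<^sub>E UNIV (\<lambda>_. {0, 1}))"
    by (simp add: compactin_PiE)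
  ultimately show ?thesis by (simp add: euclidean_product_topology)
qed

lemma summable_digit_series:
  assumes "c \<in> cantor_cube" "0 \<le> q" "q < 1"
  shows "summable (\<lambda>n. c n * q ^ n)"
proof (rule summable_comparison_test')
  show "summable (\<lambda>n. q ^ n)" using assms by (intro summable_geometric) auto
  fix n show "norm (c n * q ^ n) \<le> q ^ n"
    using assms by (cases "c n = 0") (auto simp: cantor_cube_def)
qed

lemma continuous_on_digit_series:
  assumes "0 \<le> q" "q < 1"
  shows "continuous_on cantor_cube (digit_series q)"
proof -
  have "uniform_limit cantor_cube (\<lambda>n c. \<Sum>i<n. c i * q ^ i) (\<lambda>c. \<Sum>i. c i * q ^ i) sequentially"
  proof (rule Weierstrass_m_test)
    show "summable (\<lambda>n. q ^ n)" using assms by (intro summable_geometric) auto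
    fix n c assume "c \<in> cantor_cube"
    then have "c n = 0 \<or> c n = 1" by (auto simp: cantor_cube_def)
    then show "norm (c n * q ^ n) \<le> q ^ n" using assms by auto
  qed
  then have "continuous_on cantor_cube (\<lambda>c. \<Sum>i. c i * q ^ i)"
    by (rule uniform_limit_theorem[rotated])
      (auto intro!: always_eventually continuous_on_sum continuous_on_mult continuous_on_const
        continuous_on_subset[OF continuous_on_product_coordinates])
  then show ?thesis by (simp add: digit_series_def[abs_def])
qed

text \<open>The tail behind the leading digit contributes at most \<open>(3/2) / 3 = 1/2\<close>,
  less than the gap 1 between the two digits, so the leading digit can be read off the sum. Shifting
  and induction recover the others. In base 2 the tail could fill the gap.\<close>

lemma inj_on_ternary_series: "inj_on (digit_series (1/3)) cantor_cube"
proof (rule inj_onI)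
  have shift: "(\<lambda>n. c (Suc n)) \<in> cantor_cube" if "c \<in> cantor_cube" for c
    using that by (auto simp: cantor_cube_def)
  have split: "digit_series (1/3) c = c 0 + digit_series (1/3) (\<lambda>n. c (Suc n)) / 3"
    if "c \<in> cantor_cube" for c
    using suminf_split_head[OF summable_digit_series[OF that, of "1/3"]]
      suminf_divide[OF summable_digit_series[OF shift[OF that], of "1/3"], of 3]
    by (simp add: digit_series_def field_simps)
  have bound: "0 \<le> digit_series (1/3) c" "digit_series (1/3) c \<le> 3/2" if "c \<in> cantor_cube" for c
  proof -
    have c: "0 \<le> c n" "c n \<le> 1" for n 
    proof -
      have "c n = 0 \<or> c n = 1" using that by (auto simp: cantor_cube_def)
      then show "0 \<le> c n" "c n \<le> 1" by auto
    qed
    show "0 \<le> digit_series (1/3) c"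
      unfolding digit_series_def using c by (intro suminf_nonneg summable_digit_series that) auto
    have "digit_series (1/3) c \<le> (\<Sum>n. (1/3) ^ n)"
      unfolding digit_series_def using c
      by (intro suminf_le summable_digit_series that summable_geometric) (auto simp: field_simps)
    also have "\<dots> = 3/2" by (subst suminf_geometric) auto
    finally show "digit_series (1/3) c \<le> 3/2" .
  qed
  have head: "c 0 = b 0" "digit_series (1/3) (\<lambda>n. c (Suc n)) = digit_series (1/3) (\<lambda>n. b (Suc n))"
    if "c \<in> cantor_cube" "b \<in> cantor_cube" "digit_series (1/3) c = digit_series (1/3) b" for b c
  proof -
    have *: "c 0 \<in> {0,1}" "b 0 \<in> {0,1}" using that by (auto simp: cantor_cube_def)
    show "c 0 = b 0"
      using * split[OF that(1)] split[OF that(2)] that(3) bound[OF shift[OF that(1)]] bound[OF shift[OF that(2)]]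
      by auto
    then show "digit_series (1/3) (\<lambda>n. c (Suc n)) = digit_series (1/3) (\<lambda>n. b (Suc n))"
      using split[OF that(1)] split[OF that(2)] that(3) by simp
  qed
  have coord: "c n = b n" if "c \<in> cantor_cube" "b \<in> cantor_cube" "digit_series (1/3) c = digit_series (1/3) b" for b c n
    using that
  proof (induction n arbitrary: b c)
    case 0 then show ?case by (rule head(1))
  next
    case (Suc n)
    show ?case by (rule Suc.IH[OF shift shift head(2)]) (fact Suc.prems)+
  qed
  fix c b assume "c \<in> cantor_cube" "b \<in> cantor_cube" "digit_series (1/3) c = digit_series (1/3) b"
  then show "c = b" using coord by (intro ext) blast
qed

section \<open>Borel sets of a topology\<close>

lemma openin_subset_Pow: "{U. openin Z U} \<subseteq> Pow (topspace Z)"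
  using openin_subset by blast

lemma space_borel_of: "space (borel_of Z) = topspace Z"
  unfolding borel_of_def by (rule space_measure_of[OF openin_subset_Pow])

lemma sets_borel_of: "sets (borel_of Z) = sigma_sets (topspace Z) {U. openin Z U}"
  unfolding borel_of_def by (rule sets_measure_of[OF openin_subset_Pow])

lemma borel_measurable_continuous_map:
  assumes "continuous_map Z euclidean f"
  shows "f \<in> borel_measurable (borel_of Z)"
proof (rule borel_measurableI)
  fix S assume "open (S :: 'b set)"
  then have "openin Z {x \<in> topspace Z. f x \<in> S}"
    using assms by (auto simp: continuous_map_def)
  moreover have "{x \<in> topspace Z. f x \<in> S} = f -` S \<inter> space (borel_of Z)"
    by (auto simp: space_borel_of)
  ultimately show "f -` S \<inter> space (borel_of Z) \<in> sets (borel_of Z)"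
    by (auto simp: sets_borel_of)
qed

section \<open>Interleaved digit codes\<close>

text \<open>\<open>prod_decode\<close> lists the digits of all coordinates in one sequence; the
  entry at \<open>(i, j)\<close> is the digit of \<open>w i\<close> with weight
  \<open>(1/2) ^ Suc j\<close>.\<close>

definition digits :: "(nat \<Rightarrow> real) \<Rightarrow> nat \<Rightarrow> real" where
  "digits w n = (case prod_decode n of (i, j) \<Rightarrow> real_of_int (\<lfloor>2 ^ Suc j * w i\<rfloor> mod 2))"

text \<open>Evaluation of the expansions. It also accepts expansions ending in ones, which
  \<open>digits\<close> never produces, and so is continuous on the whole cube although
  \<open>digits\<close> is not continuous.\<close>

definition undigits :: "(nat \<Rightarrow> real) \<Rightarrow> nat \<Rightarrow> real" where
  "undigits c i = digit_series (1/2) (\<lambda>j. c (prod_encode (i, j))) / 2"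

lemma digits_in_cantor_cube: "digits w \<in> cantor_cube"
  unfolding cantor_cube_def digits_def by (auto split: prod.split) 

lemma undigits_digits:
  assumes "\<And>i. 0 \<le> w i" "\<And>i. w i < 1"
  shows "undigits (digits w) = w"
proof
  fix i
  have "(\<Sum>j. real_of_int (\<lfloor>2 ^ Suc j * w i\<rfloor> mod 2) / 2 ^ Suc j) = w i"
    using binary_digit_sums[OF assms] by (rule sums_unique[symmetric])
  moreover have "summable (\<lambda>j. digits w (prod_encode (i, j)) * (1/2) ^ j)"
    using digits_in_cantor_cube[of w] by (intro summable_digit_series) (auto simp: cantor_cube_def)
  ultimately show "undigits (digits w) i = w i"
    by (simp add: undigits_def digit_series_def suminf_divide[symmetric])
      (simp add: digits_def field_simps)
qed

lemma continuous_on_undigits: "continuous_on cantor_cube undigits"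
proof (rule continuous_on_coordinatewise_then_product)
  fix i
  have "continuous_on cantor_cube (\<lambda>c j. c (prod_encode (i, j)) :: real)"
    by (intro continuous_on_coordinatewise_then_product
        continuous_on_subset[OF continuous_on_product_coordinates]) auto
  then have "continuous_on cantor_cube (\<lambda>c. digit_series (1/2) (\<lambda>j. c (prod_encode (i, j))))"
    by (intro continuous_on_compose2[OF continuous_on_digit_series[of "1/2"]]) (auto simp: cantor_cube_def)
  then show "continuous_on cantor_cube (\<lambda>c. undigits c i)"
    unfolding undigits_def by (intro continuous_intros) auto
qed

lemma tendsto_floor_eq:
  fixes x :: real
  assumes "x \<notin> \<int>" "(f \<longlongrightarrow> x) F"
  shows "\<forall>\<^sub>F n in F. \<lfloor>f n\<rfloor> = \<lfloor>x\<rfloor>"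
proof -
  have "of_int \<lfloor>x\<rfloor> < x"
    using assms(1) by (metis Ints_of_int floor_le_iff le_less of_int_floor_le)
  then have "\<forall>\<^sub>F n in F. of_int \<lfloor>x\<rfloor> < f n" "\<forall>\<^sub>F n in F. f n < of_int \<lfloor>x\<rfloor> + 1"
    using assms(2) by (auto intro: order_tendstoD)
  then show ?thesis
    by eventually_elim (auto simp: floor_eq_iff)
qed

text \<open>Away from dyadic values every floor involved is locally constant, so each digit is
  eventually constant, and convergence of digit sequences is coordinatewise.\<close>

lemma tendsto_digits:
  assumes "\<And>i. ((\<lambda>n. W n i) \<longlongrightarrow> w i) F" "\<And>i j. 2 ^ Suc j * w i \<notin> \<int>"
  shows "((\<lambda>n. digits (W n)) \<longlongrightarrow> digits w) F"
proof -
  have "((\<lambda>n. digits (W n) k) \<longlongrightarrow> digits w k) F" for k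
  proof -
    obtain i j where ij: "prod_decode k = (i, j)" by fastforce
    have "\<forall>\<^sub>F n in F. \<lfloor>2 ^ Suc j * W n i\<rfloor> = \<lfloor>2 ^ Suc j * w i\<rfloor>"
      by (intro tendsto_floor_eq assms tendsto_intros)
    then have "\<forall>\<^sub>F n in F. digits (W n) k = digits w k"
      by eventually_elim (simp add: digits_def ij)
    then show ?thesis by (rule tendsto_eventually)
  qed
  then have "limitin (product_topology (\<lambda>_. euclidean) UNIV) (\<lambda>n. digits (W n)) (digits w) F"
    by (simp add: limitin_componentwise)
  then show ?thesis by (simp add: euclidean_product_topology)
qed

text \<open>Adding \<open>s\<close> to every coordinate makes all digit expansions continuous in \<open>z\<close> outside
  a countable set of \<open>s\<close>; the coordinate \<open>f 0 = 0\<close> allows \<open>s\<close> to be recovered.\<close>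

lemma Borel_coding:
  fixes Z :: "'z topology"
  assumes Z: "compact_space Z" "metrizable_space Z"
  obtains \<Phi> :: "real \<times> 'z \<Rightarrow> real" and C \<Psi> where
    "\<Phi> \<in> borel_measurable (borel \<Otimes>\<^sub>M borel_of Z)"
    "compact C" "\<Phi> ` ({0..1} \<times> topspace Z) \<subseteq> C"
    "continuous_map (top_of_set C) (prod_topology (top_of_set {0..1}) Z) \<Psi>"
    "\<forall>x\<in>{0..1} \<times> topspace Z. \<Psi> (\<Phi> x) = x"
    "\<forall>z\<in>topspace Z. \<exists>N. countable N \<and> (\<forall>s\<in>{0..1} - N. \<forall>\<sigma>.
        limitin Z \<sigma> z sequentially \<longrightarrow> (\<lambda>n. \<Phi> (s, \<sigma> n)) \<longlonglongrightarrow> \<Phi> (s, z))"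
proof -
  obtain g :: "nat \<Rightarrow> 'z \<Rightarrow> real" where g: "\<And>i. continuous_map Z euclideanreal (g i)"
      "\<And>i z. g i z \<in> {0..1}"
      "\<And>x y. x \<in> topspace Z \<Longrightarrow> y \<in> topspace Z \<Longrightarrow> (\<And>i. g i x = g i y) \<Longrightarrow> x = y"
    using compact_metrizable_separating_functions[OF Z] by blast
  define f where "f i = (case i of 0 \<Rightarrow> (\<lambda>_. 0) | Suc i \<Rightarrow> g i)" for i :: nat
  have f: "\<And>i. continuous_map Z euclideanreal (f i)" "\<And>i z. f i z \<in> {0..1}"
      "\<And>x y. x \<in> topspace Z \<Longrightarrow> y \<in> topspace Z \<Longrightarrow> (\<And>i. f i x = f i y) \<Longrightarrow> x = y"
      "\<And>z. f 0 z = 0"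
    using g by (auto simp: f_def split: nat.split) (metis nat.case(2))
  define X where "X = prod_topology (top_of_set {0..1::real}) Z"
  have topX: "topspace X = {0..1} \<times> topspace Z" by (simp add: X_def)
  \<comment> \<open>For \<open>s\<close> in \<open>[0, 1]\<close> the numerator lies in
    \<open>[0, 2]\<close>; the divisor 3 keeps the quotient strictly below 1, as
    \<open>undigits_digits\<close> demands.\<close>
  define W where "W x i = (fst x + f i (snd x)) / 3" for x :: "real \<times> 'z" and i
  have W01: "0 \<le> W (s, z) i" "W (s, z) i < 1" if "s \<in> {0..1}" for s z i
    using that f(2)[of i z] by (auto simp: W_def)
  have contW: "continuous_map X euclidean W"
  proof -
    have fst: "continuous_map X euclideanreal fst"
      unfolding X_def by (metis continuous_map_fst continuous_map_into_fulltopology)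
    have "continuous_map X euclideanreal (\<lambda>x. W x i)" for i
      unfolding W_def using fst continuous_map_compose[OF continuous_map_snd f(1)[of i], of "top_of_set {0..1::real}"]
      by (intro continuous_intros) (auto simp: X_def o_def)
    then show ?thesis
      by (simp add: euclidean_product_topology[symmetric] continuous_map_componentwise_UNIV)
  qed
  have injW: "inj_on W (topspace X)"
  proof (rule inj_onI, clarify)
    fix s z s' z' assume x: "(s, z) \<in> topspace X" "(s', z') \<in> topspace X" "W (s, z) = W (s', z')"
    have eq: "s + f i z = s' + f i z'" for i using fun_cong[OF x(3), of i] by (simp add: W_def)
    have "s = s'" using eq[of 0] f(4) by simp
    then show "s = s' \<and> z = z'" using eq f(3)[of z z'] x by (auto simp: topX)
  qed
  have compX: "compact_space X"
    unfolding X_def using Z(1) by (simp add: compact_space_prod_topology compact_space_subtopology)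
  \<comment> \<open>A continuous injection of a compact space into a Hausdorff space is an
    embedding; this yields the continuous inverse \<open>V\<close> on the image.\<close>
  have "embedding_map X euclidean W"
    by (intro continuous_imp_embedding_map compX contW injW Hausdorff_space_euclidean)
  then obtain V where V: "homeomorphic_maps X (top_of_set (W ` topspace X)) W V"
    unfolding embedding_map_def homeomorphic_map_maps by auto
  have compW: "compact (W ` topspace X)"
    using image_compactin[OF _ contW, of "topspace X"] compX by (simp add: compact_space_def)
  \<comment> \<open>The codes \<open>digits (W x)\<close> need not form a closed set.
    \<open>K\<close> admits every expansion of a point of the image, which makes it the preimage of
    a compact set under the continuous \<open>undigits\<close>, hence compact.\<close>
  define K where "K = cantor_cube \<inter> undigits -` (W ` topspace X)"
  have "compact K"
  proof -
    have "closedin (top_of_set cantor_cube) K"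
      unfolding K_def using compW continuous_on_undigits
      by (intro continuous_closedin_preimage compact_imp_closed)
    then show ?thesis using compact_cantor_cube closedin_compact by blast
  qed
  have Ksub: "K \<subseteq> cantor_cube" by (auto simp: K_def)
  \<comment> \<open>The ternary series is a continuous injection on the compact set
    \<open>K\<close>, so this inverse is continuous on the image of \<open>K\<close>.\<close>
  define D where "D = the_inv_into K (digit_series (1/3))"
  have contS: "continuous_on K (digit_series (1/3))"
    using continuous_on_digit_series[of "1/3"] Ksub by (auto intro: continuous_on_subset)
  have injS: "inj_on (digit_series (1/3)) K"
    using inj_on_ternary_series Ksub by (rule inj_on_subset)
  define \<Phi> where "\<Phi> x = digit_series (1/3) (digits (W x))" for x
  define \<Psi> where "\<Psi> = V \<circ> (undigits \<circ> D)"
  define C where "C = digit_series (1/3) ` K"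
  have dW: "digits (W x) \<in> K" "undigits (digits (W x)) = W x" if "x \<in> topspace X" for x
  proof -
    show "undigits (digits (W x)) = W x"
      using that W01 by (intro undigits_digits) (auto simp: topX)
    then show "digits (W x) \<in> K"
      using that digits_in_cantor_cube by (auto simp: K_def)
  qed
  show thesis
  proof
    show "\<Phi> \<in> borel_measurable (borel \<Otimes>\<^sub>M borel_of Z)"
    proof -
      have [measurable]: "f i \<in> borel_measurable (borel_of Z)" for i
        by (rule borel_measurable_continuous_map[OF f(1)])
      have [measurable]: "(\<lambda>x. W x i) \<in> borel_measurable (borel \<Otimes>\<^sub>M borel_of Z)" for i
        unfolding W_def by measurable
      have "(\<lambda>x. digits (W x) n) \<in> borel_measurable (borel \<Otimes>\<^sub>M borel_of Z)" for n
        by (cases "prod_decode n") (simp add: digits_def)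
      then show ?thesis
        unfolding \<Phi>_def digit_series_def by measurable
    qed
    show "compact C"
      unfolding C_def using contS \<open>compact K\<close> by (rule compact_continuous_image)
    show "\<Phi> ` ({0..1} \<times> topspace Z) \<subseteq> C"
      using dW(1) by (auto simp: C_def \<Phi>_def topX)
    show "continuous_map (top_of_set C) (prod_topology (top_of_set {0..1}) Z) \<Psi>"
      unfolding \<Psi>_def X_def[symmetric]
    proof (rule continuous_map_compose)
      have D: "continuous_on C D" "D ` C \<subseteq> K"
        unfolding C_def D_def using continuous_on_inv_into[OF contS \<open>compact K\<close> injS]
        by (auto simp: the_inv_into_f_f[OF injS])
      have "continuous_on C (undigits \<circ> D)"
        using D Ksub by (intro continuous_on_compose continuous_on_subset[OF continuous_on_undigits]) auto
      moreover have "(undigits \<circ> D) ` C \<subseteq> W ` topspace X"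
        using D(2) by (auto simp: K_def)
      ultimately show "continuous_map (top_of_set C) (top_of_set (W ` topspace X)) (undigits \<circ> D)"
        by auto
      show "continuous_map (top_of_set (W ` topspace X)) X V"
        using V by (simp add: homeomorphic_maps_def)
    qed
    show "\<forall>x\<in>{0..1} \<times> topspace Z. \<Psi> (\<Phi> x) = x"
    proof
      fix x :: "real \<times> 'z" assume "x \<in> {0..1} \<times> topspace Z"
      then have x: "x \<in> topspace X" by (simp add: topX)
      have "D (\<Phi> x) = digits (W x)"
        unfolding D_def \<Phi>_def by (rule the_inv_into_f_f[OF injS dW(1)[OF x]])
      then show "\<Psi> (\<Phi> x) = x"
        using dW(2)[OF x] V x by (simp add: \<Psi>_def homeomorphic_maps_def)
    qed
    show "\<forall>z\<in>topspace Z. \<exists>N. countable N \<and> (\<forall>s\<in>{0..1} - N. \<forall>\<sigma>.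
        limitin Z \<sigma> z sequentially \<longrightarrow> (\<lambda>n. \<Phi> (s, \<sigma> n)) \<longlonglongrightarrow> \<Phi> (s, z))"
    proof (intro ballI exI conjI allI impI)
      fix z assume "z \<in> topspace Z"
      \<comment> \<open>These are the solutions \<open>s\<close> of
        \<open>2 ^ Suc j * W (s, z) i = of_int m\<close>, that is, the shifts putting some
        coordinate at a jump of one of its digits.\<close>
      let ?N = "\<Union>i j. (\<lambda>m. 3 * of_int m / 2 ^ Suc j - f i z) ` (UNIV :: int set)"
      show "countable ?N" by auto
      fix s \<sigma> assume s: "s \<in> {0..1} - ?N" and lim: "limitin Z \<sigma> z sequentially"
      have "2 ^ Suc j * W (s, z) i \<notin> \<int>" for i j
      proof
        assume "2 ^ Suc j * W (s, z) i \<in> \<int>"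
        then obtain m where "2 ^ Suc j * W (s, z) i = of_int m" by (elim Ints_cases)
        then have "s = 3 * of_int m / 2 ^ Suc j - f i z" by (simp add: W_def field_simps)
        then show False using s by blast
      qed
      moreover have "(\<lambda>n. W (s, \<sigma> n) i) \<longlonglongrightarrow> W (s, z) i" for i
      proof -
        have "(\<lambda>n. f i (\<sigma> n)) \<longlonglongrightarrow> f i z"
          using continuous_map_limit[OF f(1) lim] by (simp add: o_def)
        then show ?thesis unfolding W_def by (auto intro!: tendsto_intros)
      qed
      ultimately have "(\<lambda>n. digits (W (s, \<sigma> n))) \<longlonglongrightarrow> digits (W (s, z))"
        by (intro tendsto_digits)
      then show "(\<lambda>n. \<Phi> (s, \<sigma> n)) \<longlonglongrightarrow> \<Phi> (s, z)"
        unfolding \<Phi>_def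
        by (intro continuous_on_tendsto_compose[OF continuous_on_digit_series[of "1/3"]]
            always_eventually allI digits_in_cantor_cube) auto
    qed
  qed
qed

section \<open>Quantile functions\<close>

text \<open>Generalized inverse of the distribution function. For \<open>u \<le> 0\<close> the
  infimum would range over all reals and for \<open>u \<ge> 1\<close> possibly over the empty set;
  on \<open>[0, 1]\<close> the default 0 touches only the two end points, a null set.\<close>

definition quantile :: "real measure \<Rightarrow> real \<Rightarrow> real" where
  "quantile \<nu> u = (if 0 < u \<and> u < 1 then Inf {x. u \<le> cdf \<nu> x} else 0)"

text \<open>Right continuity of the distribution function makes the infimum attained. The resulting
  adjunction turns comparisons of quantiles with a fixed \<open>r\<close> into comparisons of
  \<open>u\<close> with a fixed number.\<close>

lemma quantile_le_iff:
  assumes "real_distribution \<nu>" "0 < u" "u < 1"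
  shows "quantile \<nu> u \<le> r \<longleftrightarrow> u \<le> cdf \<nu> r"
proof -
  interpret cdf_distribution \<nu> by (simp add: cdf_distribution_def assms(1))
  have "quantile \<nu> u = I u" using assms(2,3) by (simp add: quantile_def)
  then show ?thesis using pseudoinverse[OF assms(2,3), of r] by argo
qed

text \<open>Left of the quantile the distribution function stays below \<open>u\<close>; without
  atoms it is continuous, so this bound survives the left limit. The other inequality is the
  adjunction.\<close>

lemma cdf_quantile:
  assumes "real_distribution \<nu>" "\<And>r. measure \<nu> {r} = 0" "0 < u" "u < 1"
  shows "cdf \<nu> (quantile \<nu> u) = u"
proof (rule antisym)
  interpret real_distribution \<nu> by fact
  have "isCont (cdf \<nu>) (quantile \<nu> u)" using assms(2) by (simp add: isCont_cdf)
  then have "(cdf \<nu> \<longlongrightarrow> cdf \<nu> (quantile \<nu> u)) (at_left (quantile \<nu> u))"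
    by (meson continuous_within filterlim_at_split isCont_def)
  moreover have "\<forall>\<^sub>F r in at_left (quantile \<nu> u). cdf \<nu> r \<le> u"
  proof (rule eventually_at_leftI[of "quantile \<nu> u - 1"])
    fix r assume "r \<in> {quantile \<nu> u - 1<..<quantile \<nu> u}"
    then show "cdf \<nu> r \<le> u" using quantile_le_iff[OF assms(1,3,4), of r] by auto
  qed simp
  ultimately show "cdf \<nu> (quantile \<nu> u) \<le> u"
    by (intro tendsto_upperbound[of "cdf \<nu>"]) auto
  show "u \<le> cdf \<nu> (quantile \<nu> u)"
    using quantile_le_iff[OF assms(1,3,4)] by blast
qed

lemma borel_measurable_quantile:
  assumes "real_distribution \<nu>"
  shows "quantile \<nu> \<in> borel_measurable borel"
proof -
  interpret cdf_distribution \<nu> by (simp add: cdf_distribution_def assms)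
  have "(\<lambda>u. if u \<in> {0<..<1} then Inf {x. u \<le> cdf \<nu> x} else 0) \<in> borel_measurable borel"
    using measurable_CI by (subst measurable_If_restrict_space_iff) (auto simp: greaterThanLessThan_eq Int_def)
  then show ?thesis by (simp add: quantile_def[abs_def])
qed

lemma sets_unit_leb: "sets unit_leb = sets (restrict_space borel {0..1})"
  by (simp add: unit_leb_def sets_restrict_space)

lemma space_unit_leb [simp]: "space unit_leb = {0..1}"
  by (simp add: unit_leb_def space_restrict_space)

lemma measurable_unit_lebI: "f \<in> borel \<rightarrow>\<^sub>M N \<Longrightarrow> f \<in> unit_leb \<rightarrow>\<^sub>M N"
  unfolding unit_leb_def by (intro measurable_restrict_space1) simp

lemma prob_space_unit_leb: "prob_space unit_leb"
  by (rule prob_spaceI) (simp add: unit_leb_def emeasure_restrict_space space_restrict_space)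

lemma AE_unit_leb: "AE u in unit_leb. 0 < u \<and> u < 1"
proof -
  have "AE u in lborel. u \<noteq> 0 \<and> u \<noteq> (1::real)"
    by (intro AE_conjI AE_lborel_singleton)
  then have "AE u in lborel. u \<in> {0..1::real} \<longrightarrow> 0 < u \<and> u < 1"
    by eventually_elim auto
  then show ?thesis
    unfolding unit_leb_def by (subst AE_restrict_space_iff) auto
qed


text \<open>This is inverse transform sampling, known as \<open>distr_I_eq_M\<close> on the open
  interval; passing to the closed interval adds only two null points.\<close>

lemma distr_quantile:
  assumes "real_distribution \<nu>"
  shows "distr unit_leb borel (quantile \<nu>) = \<nu>"
proof -
  interpret cdf_distribution \<nu> by (simp add: cdf_distribution_def assms)
  let ?\<Omega> = "restrict_space lborel {0<..<1::real}"
  have q[measurable]: "quantile \<nu> \<in> borel_measurable borel"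
    by (rule borel_measurable_quantile[OF assms])
  have "distr unit_leb borel (quantile \<nu>) = distr ?\<Omega> borel (quantile \<nu>)"
  proof (rule measure_eqI)
    fix E assume "E \<in> sets (distr unit_leb borel (quantile \<nu>))"
    then have E[measurable]: "E \<in> sets borel" by simp
    have m: "quantile \<nu> -` E \<in> sets borel"
      using measurable_sets[OF q E] by simp
    have "AE u in lborel. u \<noteq> 0 \<and> u \<noteq> (1::real)"
      by (intro AE_conjI AE_lborel_singleton)
    then have "AE u in lborel. u \<in> quantile \<nu> -` E \<inter> {0..1} \<longleftrightarrow> u \<in> quantile \<nu> -` E \<inter> {0<..<1}"
      by eventually_elim auto
    then have "emeasure lborel (quantile \<nu> -` E \<inter> {0..1}) = emeasure lborel (quantile \<nu> -` E \<inter> {0<..<1})"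
      using m by (intro emeasure_eq_AE) auto
    moreover have "quantile \<nu> \<in> unit_leb \<rightarrow>\<^sub>M borel" "quantile \<nu> \<in> ?\<Omega> \<rightarrow>\<^sub>M borel"
      using q by (auto intro: measurable_unit_lebI measurable_restrict_space1)
    ultimately show "emeasure (distr unit_leb borel (quantile \<nu>)) E = emeasure (distr ?\<Omega> borel (quantile \<nu>)) E"
      using E by (simp add: emeasure_distr unit_leb_def emeasure_restrict_space space_restrict_space)
  qed simp
  also have "\<dots> = distr ?\<Omega> borel I"
    by (rule distr_cong) (auto simp: quantile_def space_restrict_space)
  also have "\<dots> = \<nu>" by (rule distr_I_eq_M)
  finally show ?thesis .
qed

section \<open>Isomorphisms modulo null sets from quantiles\<close>

text \<open>The inverse is \<open>F \<circ> \<Phi>\<close>, where \<open>F\<close> is the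
  distribution function of the law of \<open>\<Phi>\<close> and \<open>Q\<close> its quantile
  function. Atomlessness gives \<open>F (Q u) = u\<close> for \<open>0 < u < 1\<close>. The
  identities \<open>Q (F r) = r\<close> and \<open>\<Phi> (\<Psi> r) = r\<close> hold only for
  almost every \<open>r\<close>, whence the restriction to conull sets.\<close>

lemma quantile_iso_mod0:
  assumes "prob_space N" and \<Phi>[measurable]: "\<Phi> \<in> borel_measurable N" and \<Psi>[measurable]: "\<Psi> \<in> borel \<rightarrow>\<^sub>M N"
    and inv: "\<And>x. x \<in> space N \<Longrightarrow> \<Psi> (\<Phi> x) = x"
    and atomless: "\<And>r. measure (distr N borel \<Phi>) {r} = 0"
  shows "iso_mod0 unit_leb N (\<Psi> \<circ> quantile (distr N borel \<Phi>))"
proof -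
  interpret N: prob_space N by fact
  interpret U: prob_space unit_leb by (rule prob_space_unit_leb)
  define \<nu> where "\<nu> = distr N borel \<Phi>"
  have \<nu>: "real_distribution \<nu>"
    unfolding \<nu>_def by (rule N.real_distribution_distr[OF \<Phi>])
  interpret cdf_distribution \<nu> by (simp add: cdf_distribution_def \<nu>)
  define F where "F = cdf \<nu>"
  define Q where "Q = quantile \<nu>"
  define k where "k = \<Psi> \<circ> Q"
  have FQ: "F (Q u) = u" if "0 < u" "u < 1" for u
    unfolding F_def Q_def using cdf_quantile[OF \<nu> _ that] atomless by (simp add: \<nu>_def)
  have Q[measurable]: "Q \<in> borel_measurable borel"
    unfolding Q_def by (rule borel_measurable_quantile[OF \<nu>])
  have F[measurable]: "F \<in> borel_measurable borel" unfolding F_def by (rule measurable_C)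
  have QU[measurable]: "Q \<in> unit_leb \<rightarrow>\<^sub>M borel" by (intro measurable_unit_lebI Q)
  have k[measurable]: "k \<in> unit_leb \<rightarrow>\<^sub>M N" unfolding k_def by measurable
  have FU: "(\<lambda>x. F (\<Phi> x)) \<in> N \<rightarrow>\<^sub>M unit_leb"
  proof -
    have "(\<lambda>x. F (\<Phi> x)) \<in> N \<rightarrow>\<^sub>M restrict_space borel {0..1}"
      by (rule measurable_restrict_space2) (auto simp: F_def cdf_nonneg cdf_bounded_prob)
    then show ?thesis by (subst measurable_cong_sets[OF refl sets_unit_leb])
  qed
  have dQ: "distr unit_leb borel Q = \<nu>" unfolding Q_def by (rule distr_quantile[OF \<nu>])
  have dk: "distr unit_leb N k = N"
  proof -
    have "distr unit_leb N k = distr (distr N borel \<Phi>) N \<Psi>"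
      unfolding k_def \<nu>_def[symmetric] dQ[symmetric] by (simp add: distr_distr)
    also have "\<dots> = distr N N (\<Psi> \<circ> \<Phi>)" by (simp add: distr_distr)
    also have "\<dots> = distr N N (\<lambda>x. x)" by (rule distr_cong) (auto simp: inv)
    finally show ?thesis by simp
  qed
  \<comment> \<open>On \<open>A\<close> and \<open>B\<close> the maps \<open>k\<close> and
    \<open>F \<circ> \<Phi>\<close> are mutually inverse by construction; what remains is that both
    sets are conull.\<close>
  define A where "A = {u \<in> space unit_leb. 0 < u \<and> u < 1 \<and> \<Phi> (\<Psi> (Q u)) = Q u}"
  define B where "B = {x \<in> space N. 0 < F (\<Phi> x) \<and> F (\<Phi> x) < 1 \<and> Q (F (\<Phi> x)) = \<Phi> x}"
  have [measurable]: "(\<lambda>u. u) \<in> unit_leb \<rightarrow>\<^sub>M borel" by (intro measurable_unit_lebI) simp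
  have A[measurable]: "A \<in> sets unit_leb" unfolding A_def by measurable
  have B[measurable]: "B \<in> sets N" unfolding B_def by measurable
  have AE_A: "AE u in unit_leb. u \<in> A"
  proof -
    \<comment> \<open>The law \<open>\<nu>\<close> charges only values of \<open>\<Phi>\<close>, and
      there \<open>\<Phi> \<circ> \<Psi>\<close> is the identity.\<close>
    have "AE r in \<nu>. \<Phi> (\<Psi> r) = r"
      unfolding \<nu>_def by (subst AE_distr_iff) (auto simp: inv)
    then have "AE u in unit_leb. \<Phi> (\<Psi> (Q u)) = Q u"
      unfolding dQ[symmetric] by (rule AE_distrD[OF QU])
    with AE_unit_leb AE_space show ?thesis by eventually_elim (auto simp: A_def)
  qed
  have AE_B: "AE x in N. x \<in> B"
  proof -
    \<comment> \<open>\<open>\<nu>\<close> is the law of both \<open>Q\<close> and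
      \<open>\<Phi>\<close>: \<open>Q (F r) = r\<close> holds at \<open>r = Q u\<close> by
      \<open>FQ\<close>, hence for \<open>\<nu>\<close>-almost every \<open>r\<close>, hence at
      \<open>\<Phi> x\<close> for almost every \<open>x\<close>.\<close>
    have "AE u in unit_leb. 0 < F (Q u) \<and> F (Q u) < 1 \<and> Q (F (Q u)) = Q u"
      using AE_unit_leb by eventually_elim (simp add: FQ)
    then have "AE r in \<nu>. 0 < F r \<and> F r < 1 \<and> Q (F r) = r"
      unfolding dQ[symmetric] by (subst AE_distr_iff) auto
    then have "AE x in N. 0 < F (\<Phi> x) \<and> F (\<Phi> x) < 1 \<and> Q (F (\<Phi> x)) = \<Phi> x"
      unfolding \<nu>_def by (rule AE_distrD[OF \<Phi>])
    with AE_space show ?thesis by eventually_elim (auto simp: B_def)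
  qed
  have kA: "k u \<in> B" "F (\<Phi> (k u)) = u" if "u \<in> A" for u
    using that FQ measurable_space[OF k] by (auto simp: A_def B_def k_def)
  have kB: "F (\<Phi> x) \<in> A" "k (F (\<Phi> x)) = x" if "x \<in> B" for x
    using that inv by (auto simp: A_def B_def k_def)
  have inj: "inj_on k A" by (metis inj_onI kA(2))
  have bij: "bij_betw k A B"
    by (rule bij_betwI[where g = "\<lambda>x. F (\<Phi> x)"]) (use kA kB in auto)
  have the_inv: "the_inv_into A k x = F (\<Phi> x)" if "x \<in> B" for x
    using the_inv_into_f_f[OF inj kB(1)[OF that]] kB(2)[OF that] by simp
  have kr: "k \<in> restrict_space unit_leb A \<rightarrow>\<^sub>M restrict_space N B"
    using kA by (intro measurable_restrict_space3 k) auto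
  have "(\<lambda>x. F (\<Phi> x)) \<in> restrict_space N B \<rightarrow>\<^sub>M restrict_space unit_leb A"
    using kB by (intro measurable_restrict_space3 FU) auto
  then have invr: "the_inv_into A k \<in> restrict_space N B \<rightarrow>\<^sub>M restrict_space unit_leb A"
    by (subst measurable_cong[where g = "\<lambda>x. F (\<Phi> x)"]) (auto simp: space_restrict_space the_inv)
  have distr: "distr (restrict_space unit_leb A) (restrict_space N B) k = restrict_space N B"
  proof (rule measure_eqI)
    fix E assume "E \<in> sets (distr (restrict_space unit_leb A) (restrict_space N B) k)"
    then have Er: "E \<in> sets (restrict_space N B)" by simp
    then have E[measurable]: "E \<in> sets N" and EB: "E \<subseteq> B" by (auto simp: sets_restrict_space_iff)
    have "emeasure (distr (restrict_space unit_leb A) (restrict_space N B) k) E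
        = emeasure (restrict_space unit_leb A) (k -` E \<inter> (space unit_leb \<inter> A))"
      using kr Er by (simp add: emeasure_distr space_restrict_space Int_commute)
    also have "\<dots> = emeasure unit_leb (k -` E \<inter> (space unit_leb \<inter> A))"
      by (rule emeasure_restrict_space) auto
    \<comment> \<open>Since \<open>A\<close> is conull, intersecting with it can be undone, and the
      unrestricted identity \<open>dk\<close> applies.\<close>
    also have "\<dots> = emeasure unit_leb (k -` E \<inter> space unit_leb)"
    proof (rule emeasure_eq_AE)
      show "k -` E \<inter> space unit_leb \<in> sets unit_leb" by measurable
      then have "(k -` E \<inter> space unit_leb) \<inter> A \<in> sets unit_leb" by (rule sets.Int[OF _ A])
      then show "k -` E \<inter> (space unit_leb \<inter> A) \<in> sets unit_leb" by (simp add: Int_assoc)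
    qed (use AE_A in \<open>auto\<close>)
    also have "\<dots> = emeasure (distr unit_leb N k) E" by (simp add: emeasure_distr)
    also have "\<dots> = emeasure (restrict_space N B) E"
      using EB by (simp add: dk emeasure_restrict_space)
    finally show "emeasure (distr (restrict_space unit_leb A) (restrict_space N B) k) E
        = emeasure (restrict_space N B) E" .
  qed simp
  have "space unit_leb - A \<in> null_sets unit_leb"
    unfolding AE_iff_null_sets[OF sets.compl_sets[OF A]] using AE_A by eventually_elim simp
  moreover have "space N - B \<in> null_sets N"
    unfolding AE_iff_null_sets[OF sets.compl_sets[OF B]] using AE_B by eventually_elim simp
  ultimately show ?thesis
    unfolding iso_mod0_def k_def[symmetric] Q_def[symmetric] \<nu>_def[symmetric]
    using A B bij kr invr distr by blast
qed

section \<open>The L2 distance between quantile functions\<close>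

text \<open>By the adjunction, \<open>r\<close> separates the two quantiles exactly when
  \<open>u\<close> lies between the two values of the distribution functions at \<open>r\<close>, an
  interval whose length is their difference. The sum comes from subadditivity over
  \<open>R\<close>.\<close>

lemma measure_quantile_separated_le:
  assumes "real_distribution \<nu>" "real_distribution \<nu>'" "finite R"
  shows "{u \<in> space unit_leb. 0 < u \<and> u < 1 \<and> (\<exists>r\<in>R. (quantile \<nu> u \<le> r) \<noteq> (quantile \<nu>' u \<le> r))} \<in> sets unit_leb"
    and "measure unit_leb {u \<in> space unit_leb. 0 < u \<and> u < 1 \<and> (\<exists>r\<in>R. (quantile \<nu> u \<le> r) \<noteq> (quantile \<nu>' u \<le> r))}
      \<le> (\<Sum>r\<in>R. \<bar>cdf \<nu> r - cdf \<nu>' r\<bar>)"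
proof -
  interpret U: prob_space unit_leb by (rule prob_space_unit_leb)
  let ?S = "\<lambda>r. {u \<in> space unit_leb. 0 < u \<and> u < 1 \<and> (u \<le> cdf \<nu> r) \<noteq> (u \<le> cdf \<nu>' r)}"
  have eq: "{u \<in> space unit_leb. 0 < u \<and> u < 1 \<and> (\<exists>r\<in>R. (quantile \<nu> u \<le> r) \<noteq> (quantile \<nu>' u \<le> r))} = (\<Union>r\<in>R. ?S r)"
    using quantile_le_iff[OF assms(1)] quantile_le_iff[OF assms(2)] by auto
  have id[measurable]: "(\<lambda>u. u) \<in> unit_leb \<rightarrow>\<^sub>M borel" by (intro measurable_unit_lebI) simp
  have S: "?S r \<in> sets unit_leb" for r by measurable
  show "{u \<in> space unit_leb. 0 < u \<and> u < 1 \<and> (\<exists>r\<in>R. (quantile \<nu> u \<le> r) \<noteq> (quantile \<nu>' u \<le> r))} \<in> sets unit_leb"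
    unfolding eq using S assms(3) by (intro sets.finite_UN) auto
  have "measure unit_leb (?S r) \<le> \<bar>cdf \<nu> r - cdf \<nu>' r\<bar>" for r
  proof -
    let ?I = "{min (cdf \<nu> r) (cdf \<nu>' r)<..max (cdf \<nu> r) (cdf \<nu>' r)}"
    have "emeasure unit_leb (?S r) = emeasure lborel (?S r)"
      unfolding unit_leb_def by (rule emeasure_restrict_space) (auto simp: space_restrict_space)
    also have "\<dots> \<le> emeasure lborel ?I"
      by (rule emeasure_mono) auto
    also have "\<dots> = ennreal \<bar>cdf \<nu> r - cdf \<nu>' r\<bar>"
      by (subst emeasure_lborel_Ioc) (auto simp: abs_if min_def max_def)
    finally show ?thesis by (simp add: U.emeasure_eq_measure)
  qed
  then show "measure unit_leb {u \<in> space unit_leb. 0 < u \<and> u < 1 \<and> (\<exists>r\<in>R. (quantile \<nu> u \<le> r) \<noteq> (quantile \<nu>' u \<le> r))}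
      \<le> (\<Sum>r\<in>R. \<bar>cdf \<nu> r - cdf \<nu>' r\<bar>)"
    unfolding eq
    by (intro order_trans[OF U.finite_measure_subadditive_finite[OF assms(3)]] sum_mono) (use S in auto)
qed

text \<open>Multiples of \<open>\<delta> / 2\<close> covering a bound for \<open>C\<close> suffice:
  if \<open>x + \<delta> \<le> y\<close>, the first of them at or above \<open>x\<close> still lies
  below \<open>y\<close>.\<close>

lemma finite_separating_grid:
  assumes "bounded C" "\<delta> > (0::real)"
  obtains R where "finite R"
    "\<And>x y. x \<in> C \<Longrightarrow> y \<in> C \<Longrightarrow> (\<And>r. r \<in> R \<Longrightarrow> x \<le> r \<longleftrightarrow> y \<le> r) \<Longrightarrow> \<bar>x - y\<bar> < \<delta>"
proof -
  obtain B where B: "\<And>x. x \<in> C \<Longrightarrow> \<bar>x\<bar> \<le> B" using assms(1) by (auto simp: bounded_iff)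
  define R where "R = (\<lambda>m. \<delta> / 2 * of_int m) ` {\<lfloor>-2 * B / \<delta>\<rfloor>..\<lceil>2 * B / \<delta>\<rceil>}"
  have sep: "\<exists>r\<in>R. x \<le> r \<and> \<not> y \<le> r" if "x \<in> C" "x + \<delta> \<le> y" for x y
  proof -
    define m where "m = \<lceil>2 * x / \<delta>\<rceil>"
    have "- B \<le> x" "x \<le> B" using B[OF that(1)] by auto
    then have "-2 * B / \<delta> \<le> 2 * x / \<delta>" "2 * x / \<delta> \<le> 2 * B / \<delta>"
      using assms(2) divide_right_mono[of "-2 * B" "2 * x" \<delta>] divide_right_mono[of "2 * x" "2 * B" \<delta>] by auto
    then have m: "m \<in> {\<lfloor>-2 * B / \<delta>\<rfloor>..\<lceil>2 * B / \<delta>\<rceil>}"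
      unfolding m_def atLeastAtMost_iff by linarith
    have "2 * x / \<delta> \<le> of_int m" "of_int m < 2 * x / \<delta> + 1"
      unfolding m_def by linarith+
    then have "x \<le> \<delta> / 2 * of_int m" "\<delta> / 2 * of_int m < x + \<delta>"
      using assms(2) by (auto simp: field_simps)
    then show ?thesis using m that by (intro bexI[of _ "\<delta> / 2 * of_int m"]) (auto simp: R_def)
  qed
  show thesis
  proof
    show "finite R" by (simp add: R_def)
    fix x y assume "x \<in> C" "y \<in> C" "\<And>r. r \<in> R \<Longrightarrow> x \<le> r \<longleftrightarrow> y \<le> r"
    then show "\<bar>x - y\<bar> < \<delta>"
      using sep[of x y] sep[of y x] by (cases "x + \<delta> \<le> y"; cases "y + \<delta> \<le> x") auto
  qed
qed

text \<open>Where no point of \<open>R\<close> separates the quantiles, \<open>H\<close> changes by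
  at most \<open>\<epsilon>\<close>, on a space of total mass 1. On the separated set the squared
  difference is at most \<open>(2 * b)\<^sup>2\<close>, and
  \<open>measure_quantile_separated_le\<close> bounds the measure of that set.\<close>

lemma quantile_L2_estimate:
  fixes H :: "real \<Rightarrow> real"
  assumes \<nu>: "real_distribution \<nu>" "real_distribution \<nu>'" and "finite R"
    and H[measurable]: "H \<in> borel_measurable borel" and b: "\<And>x. \<bar>H x\<bar> \<le> b"
    and C: "AE r in \<nu>. r \<in> C" "AE r in \<nu>'. r \<in> C"
    and osc: "\<And>x y. x \<in> C \<Longrightarrow> y \<in> C \<Longrightarrow> (\<And>r. r \<in> R \<Longrightarrow> x \<le> r \<longleftrightarrow> y \<le> r) \<Longrightarrow> \<bar>H x - H y\<bar> \<le> \<epsilon>"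
  shows "(\<integral>u. (H (quantile \<nu> u) - H (quantile \<nu>' u))\<^sup>2 \<partial>unit_leb)
    \<le> \<epsilon>\<^sup>2 + (2 * b)\<^sup>2 * (\<Sum>r\<in>R. \<bar>cdf \<nu> r - cdf \<nu>' r\<bar>)"
proof -
  interpret U: prob_space unit_leb by (rule prob_space_unit_leb)
  define S where "S = {u \<in> space unit_leb. 0 < u \<and> u < 1 \<and> (\<exists>r\<in>R. (quantile \<nu> u \<le> r) \<noteq> (quantile \<nu>' u \<le> r))}"
  have S[measurable]: "S \<in> sets unit_leb"
    and mS: "measure unit_leb S \<le> (\<Sum>r\<in>R. \<bar>cdf \<nu> r - cdf \<nu>' r\<bar>)"
    unfolding S_def using measure_quantile_separated_le[OF \<nu> \<open>finite R\<close>] by auto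
  have qm[measurable]: "quantile \<nu> \<in> unit_leb \<rightarrow>\<^sub>M borel" "quantile \<nu>' \<in> unit_leb \<rightarrow>\<^sub>M borel"
    by (auto intro!: measurable_unit_lebI borel_measurable_quantile \<nu>)
  have inC: "AE u in unit_leb. quantile \<nu> u \<in> C" "AE u in unit_leb. quantile \<nu>' u \<in> C"
    using AE_distrD[OF qm(1), of "\<lambda>r. r \<in> C"] AE_distrD[OF qm(2), of "\<lambda>r. r \<in> C"] C
    unfolding distr_quantile[OF \<nu>(1)] distr_quantile[OF \<nu>(2)] by blast+
  have "AE u in unit_leb. (H (quantile \<nu> u) - H (quantile \<nu>' u))\<^sup>2 \<le> \<epsilon>\<^sup>2 + (2 * b)\<^sup>2 * indicator S u"
    using inC AE_unit_leb AE_space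
  proof eventually_elim
    case (elim u)
    let ?d = "H (quantile \<nu> u) - H (quantile \<nu>' u)"
    show ?case
    proof (cases "u \<in> S")
      case True
      have "\<bar>?d\<bar> \<le> \<bar>2 * b\<bar>"
        using b[of "quantile \<nu> u"] b[of "quantile \<nu>' u"] by linarith
      then have "?d\<^sup>2 \<le> (2 * b)\<^sup>2" by (simp only: abs_le_square_iff)
      then have "?d\<^sup>2 \<le> \<epsilon>\<^sup>2 + (2 * b)\<^sup>2" using zero_le_power2[of \<epsilon>] by linarith
      then show ?thesis using True by simp
    next
      case False
      then have "\<bar>?d\<bar> \<le> \<epsilon>" using elim by (intro osc) (auto simp: S_def)
      then have "\<bar>?d\<bar> \<le> \<bar>\<epsilon>\<bar>" by linarith
      then have "?d\<^sup>2 \<le> \<epsilon>\<^sup>2" by (simp only: abs_le_square_iff)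
      then show ?thesis using False by simp
    qed
  qed
  moreover have "integrable unit_leb (\<lambda>u. (H (quantile \<nu> u) - H (quantile \<nu>' u))\<^sup>2)"
  proof (rule U.integrable_const_bound[where B = "(2 * b)\<^sup>2"])
    have "\<bar>H x - H y\<bar> \<le> \<bar>2 * b\<bar>" for x y using b[of x] b[of y] by linarith
    then have "(H x - H y)\<^sup>2 \<le> (2 * b)\<^sup>2" for x y by (simp only: abs_le_square_iff)
    then show "AE u in unit_leb. norm ((H (quantile \<nu> u) - H (quantile \<nu>' u))\<^sup>2) \<le> (2 * b)\<^sup>2"
      by auto
  qed measurable
  moreover have iS: "integrable unit_leb (\<lambda>u. (2 * b)\<^sup>2 * indicator S u :: real)"
    by (intro integrable_mult_right integrable_real_indicator S) (simp add: U.emeasure_eq_measure)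
  ultimately have "(\<integral>u. (H (quantile \<nu> u) - H (quantile \<nu>' u))\<^sup>2 \<partial>unit_leb)
      \<le> (\<integral>u. \<epsilon>\<^sup>2 + (2 * b)\<^sup>2 * indicator S u \<partial>unit_leb)"
    using iS by (intro integral_mono_AE) auto
  also have "\<dots> = \<epsilon>\<^sup>2 + (2 * b)\<^sup>2 * measure unit_leb S"
    using iS U.prob_space sets.Int_space_eq2[OF S] by (subst Bochner_Integration.integral_add) auto
  also have "\<dots> \<le> \<epsilon>\<^sup>2 + (2 * b)\<^sup>2 * (\<Sum>r\<in>R. \<bar>cdf \<nu> r - cdf \<nu>' r\<bar>)"
    using mS by (intro add_left_mono mult_left_mono) auto
  finally show ?thesis .
qed

section \<open>Dependence on the measure\<close>

lemma continuous_map_integral_weak_star: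
  assumes "continuous_map Z euclideanreal f"
  shows "continuous_map (weak_star_topology Z) euclideanreal (\<lambda>\<mu>. \<integral>z. f z \<partial>\<mu>)"
proof -
  have "openin (weak_star_topology Z) {\<mu> \<in> Prob Z. (\<integral>z. f z \<partial>\<mu>) \<in> U}" if "open U" for U
    unfolding weak_star_topology_def using assms that by (intro topology_generated_by_Basis) blast
  then show ?thesis by (simp add: continuous_map_def topspace_weak_star_topology)
qed

lemma sets_Prob: "\<mu> \<in> Prob Z \<Longrightarrow> sets \<mu> = sets (borel_of Z)"
  and prob_space_Prob: "\<mu> \<in> Prob Z \<Longrightarrow> prob_space \<mu>"
  by (auto simp: Prob_def)

lemma space_Prob: "\<mu> \<in> Prob Z \<Longrightarrow> space \<mu> = topspace Z"
  using sets_eq_imp_space_eq[OF sets_Prob] by (simp add: space_borel_of)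

text \<open>A relatively open subset of \<open>C\<close> is \<open>C \<inter> T\<close> with
  \<open>T\<close> open, hence Borel; the constant value contributes either nothing or the
  complement of \<open>C\<close>.\<close>

lemma measurable_borel_of_if:
  fixes C :: "'a::topological_space set"
  assumes "closed C" "continuous_map (top_of_set C) Z g" "z0 \<in> topspace Z"
  shows "(\<lambda>r. if r \<in> C then g r else z0) \<in> borel \<rightarrow>\<^sub>M borel_of Z"
proof (rule measurable_sigma_sets[OF sets_borel_of openin_subset_Pow])
  show "(\<lambda>r. if r \<in> C then g r else z0) \<in> space borel \<rightarrow> topspace Z"
    using assms by (auto simp: continuous_map_def Pi_iff)
  fix U assume "U \<in> {U. openin Z U}"
  then have "openin (top_of_set C) {r \<in> C. g r \<in> U}"
    using assms(2) by (auto simp: continuous_map_def)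
  then obtain T where T: "open T" "{r \<in> C. g r \<in> U} = C \<inter> T" by (auto simp: openin_open)
  have "(\<lambda>r. if r \<in> C then g r else z0) -` U \<inter> space borel
      = (C \<inter> T) \<union> (if z0 \<in> U then - C else {})"
    unfolding T(2)[symmetric] by (auto split: if_splits)
  then show "(\<lambda>r. if r \<in> C then g r else z0) -` U \<inter> space borel \<in> sets borel"
    using T(1) assms(1) by auto
qed

text \<open>One measurability statement about \<open>\<Phi>\<close>, free of \<open>\<mu>\<close>,
  thus serves every \<open>\<mu>\<close>: the identity map is measurable from the product with
  \<open>\<mu>\<close> to the Borel product.\<close>

lemma measurable_pair_Prob:
  assumes "\<Phi> \<in> borel \<Otimes>\<^sub>M borel_of Z \<rightarrow>\<^sub>M N" "\<mu> \<in> Prob Z"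
  shows "\<Phi> \<in> unit_leb \<Otimes>\<^sub>M \<mu> \<rightarrow>\<^sub>M N"
proof -
  have "(\<lambda>u. u) \<in> unit_leb \<rightarrow>\<^sub>M borel" by (intro measurable_unit_lebI) simp
  moreover have "(\<lambda>z. z) \<in> \<mu> \<rightarrow>\<^sub>M borel_of Z"
    using sets_Prob[OF assms(2)] by (simp add: measurable_ident_sets)
  ultimately have "(\<lambda>x. (fst x, snd x)) \<in> unit_leb \<Otimes>\<^sub>M \<mu> \<rightarrow>\<^sub>M borel \<Otimes>\<^sub>M borel_of Z"
    by (intro measurable_Pair measurable_compose[OF measurable_fst] measurable_compose[OF measurable_snd])
  then show ?thesis using measurable_compose[OF _ assms(1)] by simp
qed

lemma measurable_section:
  assumes "\<Phi> \<in> borel \<Otimes>\<^sub>M borel_of Z \<rightarrow>\<^sub>M N" "z \<in> topspace Z"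
  shows "(\<lambda>s. \<Phi> (s, z)) \<in> unit_leb \<rightarrow>\<^sub>M N"
proof -
  have "(\<lambda>s. \<Phi> (s, z)) \<in> borel \<rightarrow>\<^sub>M N"
    using assms(2) by (intro measurable_Pair1[OF assms(1)]) (simp add: space_borel_of)
  then show ?thesis by (rule measurable_unit_lebI)
qed

section \<open>Countable exceptional sets and the law of the code\<close>

lemma countable_subsingleton:
  assumes "\<And>s t. s \<in> E \<Longrightarrow> t \<in> E \<Longrightarrow> s = t"
  shows "countable E"
proof (cases "E = {}")
  case False
  then obtain s where "s \<in> E" by blast
  then have "E \<subseteq> {s}" using assms by blast
  then show ?thesis by (rule countable_subset) simp
qed simp

lemma AE_unit_leb_countable:
  assumes "countable N"
  shows "AE s in unit_leb. s \<notin> N"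
proof -
  have "AE s in lborel. s \<notin> N"
    using assms by (intro AE_not_in countable_imp_null_set_lborel)
  then have "AE s in lborel. s \<in> {0..1} \<longrightarrow> s \<notin> N" by eventually_elim simp
  then show ?thesis unfolding unit_leb_def by (subst AE_restrict_space_iff) auto
qed

text \<open>Each fibre function \<open>\<lambda>s. \<Phi> (s, z)\<close> has an atomless distribution, so the indicator of a
  half-line, though discontinuous, does not see its jump.\<close>

lemma continuous_map_fibre_cdf:
  fixes \<Phi> :: "real \<times> 'z \<Rightarrow> real"
  assumes Z: "metrizable_space Z" and \<Phi>: "\<Phi> \<in> borel_measurable (borel \<Otimes>\<^sub>M borel_of Z)"
    and inj: "inj_on \<Phi> ({0..1} \<times> topspace Z)"
    and cont: "\<And>z. z \<in> topspace Z \<Longrightarrow> \<exists>N. countable N \<and> (\<forall>s\<in>{0..1} - N. \<forall>\<sigma>.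
        limitin Z \<sigma> z sequentially \<longrightarrow> (\<lambda>n. \<Phi> (s, \<sigma> n)) \<longlonglongrightarrow> \<Phi> (s, z))"
  shows "continuous_map Z euclideanreal (\<lambda>z. \<integral>s. indicator {..r} (\<Phi> (s, z)) \<partial>unit_leb)"
proof (rule continuous_map_sequentiallyI[OF Z])
  interpret U: prob_space unit_leb by (rule prob_space_unit_leb)
  fix \<sigma> z assume \<sigma>: "range \<sigma> \<subseteq> topspace Z" and lim: "limitin Z \<sigma> z sequentially"
  have z: "z \<in> topspace Z" using lim by (rule limitin_topspace)
  obtain N where N: "countable N" "\<And>s. s \<in> {0..1} - N \<Longrightarrow> (\<lambda>n. \<Phi> (s, \<sigma> n)) \<longlonglongrightarrow> \<Phi> (s, z)"
    using cont[OF z] lim by blast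
  \<comment> \<open>Injectivity of \<open>\<Phi>\<close> leaves at most one \<open>s\<close> whose
    limit value hits the jump \<open>r\<close>; outside \<open>N\<close> and this set the indicators
    converge.\<close>
  let ?E = "{s \<in> {0..1}. \<Phi> (s, z) = r}"
  have "countable ?E"
  proof (rule countable_subsingleton)
    fix s t assume "s \<in> ?E" "t \<in> ?E"
    then show "s = t" using inj_onD[OF inj, of "(s, z)" "(t, z)"] z by auto
  qed
  with N(1) have "AE s in unit_leb. s \<notin> N \<union> ?E" by (intro AE_unit_leb_countable) auto
  then have ae: "AE s in unit_leb. (\<lambda>n. indicator {..r} (\<Phi> (s, \<sigma> n)) :: real) \<longlonglongrightarrow> indicator {..r} (\<Phi> (s, z))"
    using AE_space
  proof eventually_elim
    case (elim s)
    then have l: "(\<lambda>n. \<Phi> (s, \<sigma> n)) \<longlonglongrightarrow> \<Phi> (s, z)" and ne: "\<Phi> (s, z) \<noteq> r" using N(2) by auto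
    have "\<forall>\<^sub>F n in sequentially. (indicator {..r} (\<Phi> (s, \<sigma> n)) :: real) = indicator {..r} (\<Phi> (s, z))"
    proof (cases "\<Phi> (s, z) < r")
      case True
      show ?thesis using order_tendstoD(2)[OF l True] by eventually_elim (use True in auto)
    next
      case False
      then have gt: "r < \<Phi> (s, z)" using ne by simp
      show ?thesis using order_tendstoD(1)[OF l gt] by eventually_elim (use False ne in auto)
    qed
    then show ?case by (rule tendsto_eventually)
  qed
  show "(\<lambda>n. \<integral>s. indicator {..r} (\<Phi> (s, \<sigma> n)) \<partial>unit_leb)
      \<longlonglongrightarrow> (\<integral>s. indicator {..r} (\<Phi> (s, z)) \<partial>unit_leb :: real)"
  proof (rule integral_dominated_convergence[where w = "\<lambda>_. 1", OF _ _ _ ae])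
    have m: "(\<lambda>s. indicator {..r} (\<Phi> (s, y)) :: real) \<in> borel_measurable unit_leb" if "y \<in> topspace Z" for y
      using measurable_section[OF \<Phi> that] by measurable
    show "(\<lambda>s. indicator {..r} (\<Phi> (s, z)) :: real) \<in> borel_measurable unit_leb" by (rule m[OF z])
    show "(\<lambda>s. indicator {..r} (\<Phi> (s, \<sigma> n)) :: real) \<in> borel_measurable unit_leb" for n
      using \<sigma> by (intro m) auto
  qed (auto simp: indicator_def)
qed

text \<open>By Fubini, integrating over \<open>s\<close> first expresses the distribution function
  as an integral against \<open>\<mu>\<close>, the form to which the weak-* topology
  applies.\<close>

lemma cdf_pair_Prob:
  assumes \<Phi>: "\<Phi> \<in> borel_measurable (borel \<Otimes>\<^sub>M borel_of Z)" and \<mu>: "\<mu> \<in> Prob Z"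
  shows "cdf (distr (unit_leb \<Otimes>\<^sub>M \<mu>) borel \<Phi>) r
    = (\<integral>z. (\<integral>s. indicator {..r} (\<Phi> (s, z)) \<partial>unit_leb) \<partial>\<mu>)"
proof -
  interpret U: prob_space unit_leb by (rule prob_space_unit_leb)
  interpret M: prob_space \<mu> by (rule prob_space_Prob[OF \<mu>])
  interpret pair_prob_space unit_leb \<mu> ..
  have [measurable]: "\<Phi> \<in> borel_measurable (unit_leb \<Otimes>\<^sub>M \<mu>)" by (rule measurable_pair_Prob[OF \<Phi> \<mu>])
  have "integrable (unit_leb \<Otimes>\<^sub>M \<mu>) (\<lambda>(s, z). indicator {..r} (\<Phi> (s, z)) :: real)"
    by (rule P.integrable_const_bound[where B = 1]) (auto simp: indicator_def)
  then have "(\<integral>z. (\<integral>s. indicator {..r} (\<Phi> (s, z)) \<partial>unit_leb) \<partial>\<mu>)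
      = (\<integral>x. indicator {..r} (\<Phi> x) \<partial>(unit_leb \<Otimes>\<^sub>M \<mu>) :: real)"
    by (subst integral_snd) (auto simp: case_prod_unfold)
  also have "\<dots> = (\<integral>x. indicator (\<Phi> -` {..r} \<inter> space (unit_leb \<Otimes>\<^sub>M \<mu>)) x \<partial>(unit_leb \<Otimes>\<^sub>M \<mu>))"
    by (rule Bochner_Integration.integral_cong) (auto simp: indicator_def)
  also have "\<dots> = measure (unit_leb \<Otimes>\<^sub>M \<mu>) (\<Phi> -` {..r} \<inter> space (unit_leb \<Otimes>\<^sub>M \<mu>))"
    by simp
  also have "\<dots> = cdf (distr (unit_leb \<Otimes>\<^sub>M \<mu>) borel \<Phi>) r"
    by (simp add: cdf_def measure_distr)
  finally show ?thesis by simp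
qed

text \<open>By injectivity the level set of \<open>r\<close> contains at most one \<open>s\<close>
  for each \<open>z\<close>, so its sections are Lebesgue null and Fubini applies. The interval
  factor removes atoms even if \<open>\<mu>\<close> has some.\<close>

lemma distr_pair_Prob_atomless:
  fixes \<Phi> :: "real \<times> 'z \<Rightarrow> real"
  assumes \<Phi>: "\<Phi> \<in> borel_measurable (borel \<Otimes>\<^sub>M borel_of Z)" and \<mu>: "\<mu> \<in> Prob Z"
    and inj: "inj_on \<Phi> ({0..1} \<times> topspace Z)"
  shows "measure (distr (unit_leb \<Otimes>\<^sub>M \<mu>) borel \<Phi>) {r} = 0"
proof -
  interpret U: prob_space unit_leb by (rule prob_space_unit_leb)
  interpret M: prob_space \<mu> by (rule prob_space_Prob[OF \<mu>])
  interpret pair_prob_space unit_leb \<mu> ..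
  have m[measurable]: "\<Phi> \<in> borel_measurable (unit_leb \<Otimes>\<^sub>M \<mu>)" by (rule measurable_pair_Prob[OF \<Phi> \<mu>])
  let ?E = "\<Phi> -` {r} \<inter> space (unit_leb \<Otimes>\<^sub>M \<mu>)"
  have sp: "space (unit_leb \<Otimes>\<^sub>M \<mu>) = {0..1} \<times> topspace Z"
    by (simp add: space_pair_measure space_Prob[OF \<mu>])
  have E: "?E \<in> sets (unit_leb \<Otimes>\<^sub>M \<mu>)" by measurable
  have "emeasure unit_leb ((\<lambda>s. (s, z)) -` ?E) = 0" for z
  proof -
    have "countable ((\<lambda>s. (s, z)) -` ?E)"
    proof (rule countable_subsingleton)
      fix s t assume "s \<in> (\<lambda>s. (s, z)) -` ?E" "t \<in> (\<lambda>s. (s, z)) -` ?E"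
      then show "s = t" using inj_onD[OF inj, of "(s, z)" "(t, z)"]
        by (auto simp: sp split: if_splits)
    qed
    then have "AE s in unit_leb. s \<notin> (\<lambda>s. (s, z)) -` ?E" by (rule AE_unit_leb_countable)
    then show ?thesis
      using AE_iff_measurable[OF sets_Pair2[OF E, of z], of "\<lambda>s. s \<notin> (\<lambda>s. (s, z)) -` ?E"]
        sets.sets_into_space[OF sets_Pair2[OF E, of z]] by blast
  qed
  then have "emeasure (unit_leb \<Otimes>\<^sub>M \<mu>) ?E = 0"
    by (simp add: emeasure_pair_measure_alt2[OF E])
  then show ?thesis by (simp add: emeasure_distr measure_def)
qed

section \<open>Construction of the family and its continuity\<close>

theorem lemma8p12:
  fixes Z :: "'z topology"
  assumes "compact_space Z" and "metrizable_space Z"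
  shows "\<exists>k :: 'z measure \<Rightarrow> real \<Rightarrow> real \<times> 'z.
    (\<forall>\<mu>\<in>Prob Z. iso_mod0 unit_leb (unit_leb \<Otimes>\<^sub>M \<mu>) (k \<mu>)) \<and>
    (\<forall>h. continuous_map (prod_topology (top_of_set {0..1}) Z) euclideanreal h \<longrightarrow>
       continuous_map (weak_star_topology Z) (L2_topology unit_leb)
         (\<lambda>\<mu>. L2_class unit_leb (h \<circ> k \<mu>)))"
proof -
  obtain \<Phi> :: "real \<times> 'z \<Rightarrow> real" and C \<Psi> where
    \<Phi>: "\<Phi> \<in> borel_measurable (borel \<Otimes>\<^sub>M borel_of Z)" and
    C: "compact C" "\<Phi> ` ({0..1} \<times> topspace Z) \<subseteq> C" and
    \<Psi>: "continuous_map (top_of_set C) (prod_topology (top_of_set {0..1}) Z) \<Psi>" and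
    inv: "\<forall>x\<in>{0..1} \<times> topspace Z. \<Psi> (\<Phi> x) = x" and
    cont: "\<forall>z\<in>topspace Z. \<exists>N. countable N \<and> (\<forall>s\<in>{0..1} - N. \<forall>\<sigma>.
        limitin Z \<sigma> z sequentially \<longrightarrow> (\<lambda>n. \<Phi> (s, \<sigma> n)) \<longlonglongrightarrow> \<Phi> (s, z))"
    by (rule Borel_coding[OF assms])
  have inj: "inj_on \<Phi> ({0..1} \<times> topspace Z)"
    by (rule inj_on_inverseI[where g = \<Psi>]) (use inv in auto)
  \<comment> \<open>\<open>z0\<close> lies in \<open>Z\<close> as soon as some probability measure
    exists; for empty \<open>Z\<close> the set \<open>Prob Z\<close> is empty too.\<close>
  define z0 where "z0 = (SOME z. z \<in> topspace Z)"
  define \<Psi>' where "\<Psi>' r = (if r \<in> C then \<Psi> r else (0, z0))" for r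
  define \<nu> where "\<nu> \<mu> = distr (unit_leb \<Otimes>\<^sub>M \<mu>) borel \<Phi>" for \<mu>
  define k where "k \<mu> = \<Psi>' \<circ> quantile (\<nu> \<mu>)" for \<mu>
  have "closed C" using C(1) by (rule compact_imp_closed)
  have m\<Phi>: "\<Phi> \<in> borel_measurable (unit_leb \<Otimes>\<^sub>M \<mu>)" if "\<mu> \<in> Prob Z" for \<mu>
    by (rule measurable_pair_Prob[OF \<Phi> that])
  have space: "space (unit_leb \<Otimes>\<^sub>M \<mu>) = {0..1} \<times> topspace Z" if "\<mu> \<in> Prob Z" for \<mu>
    by (simp add: space_pair_measure space_Prob[OF that])
  have prob: "prob_space (unit_leb \<Otimes>\<^sub>M \<mu>)" if "\<mu> \<in> Prob Z" for \<mu>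
    by (intro prob_space_pair prob_space_unit_leb prob_space_Prob[OF that])
  have \<nu>: "real_distribution (\<nu> \<mu>)" if "\<mu> \<in> Prob Z" for \<mu>
    unfolding \<nu>_def by (rule prob_space.real_distribution_distr[OF prob[OF that] m\<Phi>[OF that]])
  have \<nu>C: "AE r in \<nu> \<mu>. r \<in> C" if \<mu>: "\<mu> \<in> Prob Z" for \<mu>
    unfolding \<nu>_def using C(2) \<open>closed C\<close> space[OF \<mu>] by (subst AE_distr_iff[OF m\<Phi>[OF \<mu>]]) auto
  have m\<Psi>: "\<Psi>' \<in> borel \<rightarrow>\<^sub>M unit_leb \<Otimes>\<^sub>M \<mu>" if \<mu>: "\<mu> \<in> Prob Z" for \<mu>
  proof -
    have "topspace Z \<noteq> {}" using prob_space.not_empty[OF prob_space_Prob[OF \<mu>]] space_Prob[OF \<mu>] by simp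
    then have z0: "z0 \<in> topspace Z" unfolding z0_def by (simp add: some_in_eq)
    \<comment> \<open>Working by components leads directly to the product sigma-algebra, without
      comparing it with the Borel sets of the product topology.\<close>
    have c1: "continuous_on C (fst \<circ> \<Psi>)" "\<And>r. r \<in> C \<Longrightarrow> fst (\<Psi> r) \<in> {0..1}"
      using continuous_map_compose[OF \<Psi> continuous_map_fst] by auto
    have c2: "continuous_map (top_of_set C) Z (snd \<circ> \<Psi>)"
      by (rule continuous_map_compose[OF \<Psi> continuous_map_snd])
    have "(\<lambda>r. if r \<in> C then (fst \<circ> \<Psi>) r else 0) \<in> borel \<rightarrow>\<^sub>M restrict_space borel {0..1}"
      using c1 \<open>closed C\<close> by (intro measurable_restrict_space2 borel_measurable_continuous_on_if) auto
    then have "(\<lambda>r. if r \<in> C then (fst \<circ> \<Psi>) r else 0) \<in> borel \<rightarrow>\<^sub>M unit_leb"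
      by (subst measurable_cong_sets[OF refl sets_unit_leb])
    moreover have "(\<lambda>r. if r \<in> C then (snd \<circ> \<Psi>) r else z0) \<in> borel \<rightarrow>\<^sub>M \<mu>"
      using measurable_borel_of_if[OF \<open>closed C\<close> c2 z0]
      by (subst measurable_cong_sets[OF refl sets_Prob[OF \<mu>]])
    ultimately have "(\<lambda>r. (if r \<in> C then (fst \<circ> \<Psi>) r else 0, if r \<in> C then (snd \<circ> \<Psi>) r else z0))
        \<in> borel \<rightarrow>\<^sub>M unit_leb \<Otimes>\<^sub>M \<mu>"
      by (rule measurable_Pair)
    moreover have "(\<lambda>r. (if r \<in> C then (fst \<circ> \<Psi>) r else 0, if r \<in> C then (snd \<circ> \<Psi>) r else z0)) = \<Psi>'"
      by (auto simp: \<Psi>'_def fun_eq_iff)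
    ultimately show ?thesis by simp
  qed
  have iso: "iso_mod0 unit_leb (unit_leb \<Otimes>\<^sub>M \<mu>) (k \<mu>)" if \<mu>: "\<mu> \<in> Prob Z" for \<mu>
    unfolding k_def \<nu>_def
  proof (rule quantile_iso_mod0[OF prob[OF \<mu>] m\<Phi>[OF \<mu>] m\<Psi>[OF \<mu>]])
    fix x assume "x \<in> space (unit_leb \<Otimes>\<^sub>M \<mu>)"
    then have "x \<in> {0..1} \<times> topspace Z" by (simp add: space[OF \<mu>])
    then show "\<Psi>' (\<Phi> x) = x" using C(2) inv by (auto simp: \<Psi>'_def)
  qed (rule distr_pair_Prob_atomless[OF \<Phi> \<mu> inj])
  \<comment> \<open>The inner integral is continuous in \<open>z\<close> by
    \<open>continuous_map_fibre_cdf\<close>, so it is a test function for the weak-* topology, for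
    every \<open>r\<close>.\<close>
  have cdf: "continuous_map (weak_star_topology Z) euclideanreal (\<lambda>\<mu>. cdf (\<nu> \<mu>) r)" for r
  proof (rule continuous_map_eq)
    show "continuous_map (weak_star_topology Z) euclideanreal
        (\<lambda>\<mu>. \<integral>z. (\<integral>s. indicator {..r} (\<Phi> (s, z)) \<partial>unit_leb) \<partial>\<mu>)"
      by (intro continuous_map_integral_weak_star continuous_map_fibre_cdf assms \<Phi> inj cont[rule_format])
  qed (simp add: \<nu>_def topspace_weak_star_topology cdf_pair_Prob[OF \<Phi>])
  have L2: "continuous_map (weak_star_topology Z) (L2_topology unit_leb) (\<lambda>\<mu>. L2_class unit_leb (h \<circ> k \<mu>))"
    if h: "continuous_map (prod_topology (top_of_set {0..1}) Z) euclideanreal h" for h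
  proof -
    interpret U: prob_space unit_leb by (rule prob_space_unit_leb)
    \<comment> \<open>\<open>h \<circ> k \<mu>\<close> is the fixed function \<open>H\<close> after
      a quantile function, so \<open>\<mu>\<close> enters only through the quantile.\<close>
    define H where "H = h \<circ> \<Psi>'"
    have cH: "continuous_on C (h \<circ> \<Psi>)"
      using continuous_map_compose[OF \<Psi> h] by simp
    have H[measurable]: "H \<in> borel_measurable borel"
    proof -
      have "(\<lambda>r. if r \<in> C then (h \<circ> \<Psi>) r else h (0, z0)) \<in> borel_measurable borel"
        using cH \<open>closed C\<close> by (intro borel_measurable_continuous_on_if) auto
      moreover have "(\<lambda>r. if r \<in> C then (h \<circ> \<Psi>) r else h (0, z0)) = H"
        by (auto simp: H_def \<Psi>'_def)
      ultimately show ?thesis by simp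
    qed
    have "bounded ((h \<circ> \<Psi>) ` C)"
      using cH C(1) by (intro compact_imp_bounded compact_continuous_image)
    then obtain b0 where b0: "\<And>r. r \<in> C \<Longrightarrow> \<bar>h (\<Psi> r)\<bar> \<le> b0"
      by (auto simp: bounded_iff)
    \<comment> \<open>The bound must also cover the default value off \<open>C\<close>, since
      \<open>quantile_L2_estimate\<close> asks for it on the whole line.\<close>
    define b where "b = max b0 \<bar>h (0, z0)\<bar>"
    have b: "\<bar>H r\<bar> \<le> b" for r
      using b0[of r] by (auto simp: b_def H_def \<Psi>'_def)
    have HL: "(\<lambda>u. H (quantile (\<nu> \<mu>) u)) \<in> L2_fun unit_leb" if \<mu>: "\<mu> \<in> Prob Z" for \<mu>
    proof -
      have [measurable]: "quantile (\<nu> \<mu>) \<in> unit_leb \<rightarrow>\<^sub>M borel"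
        by (intro measurable_unit_lebI borel_measurable_quantile \<nu> \<mu>)
      have "integrable unit_leb (\<lambda>u. (H (quantile (\<nu> \<mu>) u))\<^sup>2)"
      proof (rule U.integrable_const_bound[where B = "b\<^sup>2"])
        have "\<bar>H r\<bar> \<le> \<bar>b\<bar>" for r using b[of r] by linarith
        then have "(H r)\<^sup>2 \<le> b\<^sup>2" for r by (simp only: abs_le_square_iff)
        then show "AE u in unit_leb. norm ((H (quantile (\<nu> \<mu>) u))\<^sup>2) \<le> b\<^sup>2" by auto
      qed measurable
      then show ?thesis by (simp add: L2_fun_def)
    qed
    have hk: "h \<circ> k \<mu> = (\<lambda>u. H (quantile (\<nu> \<mu>) u))" for \<mu>
      by (auto simp: k_def H_def)
    interpret L2: Metric_space "L2 unit_leb" "L2_dist unit_leb" by (rule Metric_space_L2)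
    show ?thesis
      unfolding L2_topology_def L2.continuous_map_to_metric topspace_weak_star_topology hk
    proof (intro ballI allI impI)
      fix \<mu> and \<epsilon> :: real assume \<mu>: "\<mu> \<in> Prob Z" and "\<epsilon> > 0"
      have "uniformly_continuous_on C (h \<circ> \<Psi>)"
        using cH C(1) by (rule compact_uniformly_continuous)
      then obtain \<delta> where \<delta>: "\<delta> > 0" "\<And>x y. x \<in> C \<Longrightarrow> y \<in> C \<Longrightarrow> \<bar>x - y\<bar> < \<delta> \<Longrightarrow> \<bar>H x - H y\<bar> < \<epsilon> / 2"
        using \<open>\<epsilon> > 0\<close> unfolding uniformly_continuous_on_def
        by (auto simp: dist_real_def H_def \<Psi>'_def dest!: spec[of _ "\<epsilon> / 2"])
      obtain R where R: "finite R"
        "\<And>x y. x \<in> C \<Longrightarrow> y \<in> C \<Longrightarrow> (\<And>r. r \<in> R \<Longrightarrow> x \<le> r \<longleftrightarrow> y \<le> r) \<Longrightarrow> \<bar>x - y\<bar> < \<delta>"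
        using finite_separating_grid[OF compact_imp_bounded[OF C(1)] \<delta>(1)] by metis
      \<comment> \<open>A finite sum of weak-* continuous functions of \<open>\<mu>'\<close>,
        vanishing at \<open>\<mu>' = \<mu>\<close>. The threshold
        \<open>\<epsilon>\<^sup>2 / 2\<close> added to the squared oscillation
        \<open>\<epsilon>\<^sup>2 / 4\<close> stays below \<open>\<epsilon>\<^sup>2\<close>.\<close>
      define G where "G \<mu>' = (2 * b)\<^sup>2 * (\<Sum>r\<in>R. \<bar>cdf (\<nu> \<mu>) r - cdf (\<nu> \<mu>') r\<bar>)" for \<mu>'
      define V where "V = {\<mu>' \<in> topspace (weak_star_topology Z). G \<mu>' \<in> {..<\<epsilon>\<^sup>2 / 2}}"
      have "continuous_map (weak_star_topology Z) euclideanreal G"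
        unfolding G_def using R(1) by (intro continuous_intros cdf) auto
      then have "openin (weak_star_topology Z) V"
        unfolding V_def by (rule openin_continuous_map_preimage) simp
      moreover have "\<mu> \<in> V"
        using \<mu> \<open>\<epsilon> > 0\<close> by (simp add: V_def G_def topspace_weak_star_topology)
      moreover have "L2_class unit_leb (\<lambda>u. H (quantile (\<nu> \<mu>') u))
          \<in> L2.mball (L2_class unit_leb (\<lambda>u. H (quantile (\<nu> \<mu>) u))) \<epsilon>" if "\<mu>' \<in> V" for \<mu>'
      proof -
        have \<mu>': "\<mu>' \<in> Prob Z" "G \<mu>' < \<epsilon>\<^sup>2 / 2"
          using that by (auto simp: V_def topspace_weak_star_topology)
        have osc: "\<bar>H x - H y\<bar> \<le> \<epsilon> / 2"
          if "x \<in> C" "y \<in> C" "\<And>r. r \<in> R \<Longrightarrow> x \<le> r \<longleftrightarrow> y \<le> r" for x y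
          using \<delta>(2)[OF that(1,2) R(2)[OF that]] by simp
        have "(\<integral>u. (H (quantile (\<nu> \<mu>) u) - H (quantile (\<nu> \<mu>') u))\<^sup>2 \<partial>unit_leb) \<le> (\<epsilon> / 2)\<^sup>2 + G \<mu>'"
          unfolding G_def
          by (rule quantile_L2_estimate[OF \<nu>[OF \<mu>] \<nu>[OF \<mu>'(1)] R(1) H b \<nu>C[OF \<mu>] \<nu>C[OF \<mu>'(1)] osc])
        also have "\<dots> < \<epsilon>\<^sup>2"
        proof -
          have "(\<epsilon> / 2)\<^sup>2 = \<epsilon>\<^sup>2 / 4" by (simp add: power_divide)
          moreover have "\<epsilon>\<^sup>2 > 0" using \<open>\<epsilon> > 0\<close> by simp
          ultimately show ?thesis using \<mu>'(2) by linarith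
        qed
        finally have "sqrt (\<integral>u. (H (quantile (\<nu> \<mu>) u) - H (quantile (\<nu> \<mu>') u))\<^sup>2 \<partial>unit_leb) < \<epsilon>"
          using \<open>\<epsilon> > 0\<close> by (intro real_less_lsqrt) auto
        then show ?thesis
          using HL[OF \<mu>] HL[OF \<mu>'(1)] by (auto simp: L2_dist_class intro: L2_def[THEN equalityD2, THEN subsetD])
      qed
      ultimately show "\<exists>V. openin (weak_star_topology Z) V \<and> \<mu> \<in> V \<and> (\<forall>\<mu>'\<in>V.
          L2_class unit_leb (\<lambda>u. H (quantile (\<nu> \<mu>') u))
          \<in> L2.mball (L2_class unit_leb (\<lambda>u. H (quantile (\<nu> \<mu>) u))) \<epsilon>)"
        by blast
    qed
  qed
  show ?thesis
    using iso L2 by (intro exI[of _ k] conjI ballI allI impI)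
qed

end
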